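(* Let $\mathcal{T}$ be a simplicial triangulation of $\Omega\subset\mathbb{R}^d$, $d\in\{2,3\}$, let $k\ge 1$, and let the spaces $\boldsymbol{V}_h^k$, $Q_h^{k-1}$, $M_h^k$, $\mathbf{BDM}_h^k$, the forms $a_h$, $\tilde b_h$, $b_h$, the norms $\|\cdot\|_{1,h}$, $\|\cdot\|$, $\|\cdot\|_\lambda$, and the matrices $A,B,C,\mathcal{B},\mathcal{S},Q,M$ be as defined in the context. Let $\alpha,c_a,c_b,\beta,\beta_\lambda,c_i>0$ be constants, independent of $h$, such that the following hold for all $\boldsymbol{u}_h,\boldsymbol{v}_h\in\boldsymbol{V}_h^k$, $q_h\in Q_h^{k-1}$, $\xi_h\in M_h^k$: $$a_h(\boldsymbol{v}_h,\boldsymbol{v}_h)\ge\alpha\|\boldsymbol{v}_h\|_{1,h}^2,\qquad |a_h(\boldsymbol{u}_h,\boldsymbol{v}_h)|\le c_a\|\boldsymbol{u}_h\|_{1,h}\|\boldsymbol{v}_h\|_{1,h},$$ $$|b_h((q_h,\xi_h),\boldsymbol{v}_h)|\le c_b\|\boldsymbol{v}_h\|_{1,h}\big(\|q_h\|^2+\|\xi_h\|_\lambda^2\big)^{1/2},$$ $$\beta\|q_h\|\le\sup_{0\neq\boldsymbol{w}_h\in\mathbf{BDM}_h^k}\frac{\tilde b_h(q_h,\boldsymbol{w}_h)}{\|\boldsymbol{w}_h\|_{1,h}},\qquad \beta_\lambda\|\xi_h\|_\lambda\le\sup_{0\ne\boldsymbol{w}_h\in\boldsymbol{V}_h^k}\frac{\sum_{F\in\mathcal{F}}\int_F[\![\boldsymbol{w}_h\cdot\boldsymbol{n}]\!]\,\xi_h\,ds}{\|\boldsymbol{w}_h\|_{1,h}},$$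 $$c_i\big(\beta^2\|q_h\|^2+\beta_\lambda^2\|\xi_h\|_\lambda^2\big)^{1/2}\le\sup_{0\neq\boldsymbol{w}_h\in\boldsymbol{V}_h^k}\frac{b_h((q_h,\xi_h),\boldsymbol{w}_h)}{\|\boldsymbol{w}_h\|_{1,h}}.$$ Let $c_I=c_i\min(\beta,\beta_\lambda)$, $$\omega_q:=\frac{\beta^2}{\min(\beta^2,\beta_\lambda^2)},\qquad \omega_m:=\frac{\beta_\lambda^2}{\min(\beta^2,\beta_\lambda^2)},$$ and let $\mathcal{M}:=\mathrm{bdiag}(\omega_q Q,\omega_m M)$ be the block diagonal matrix with blocks $\omega_qQ$ and $\omega_mM$. Then $\mathcal{M}$ is spectrally equivalent to $\mathcal{S}$, and satisfies the bounds $$\frac{c_I}{\sqrt{c_a}}\le\frac{\mathbf{q}^T\mathcal{S}\mathbf{q}}{\mathbf{q}^T\mathcal{M}\mathbf{q}}\le\frac{c_b}{\sqrt{\alpha}}\qquad\text{for all } 0\neq\mathbf{q}\in\mathbb{R}^{n_p+n_l}.$$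
   Context: Mesh. $\mathcal{T}$ is a triangulation of $\Omega$ into simplices $K$; $\mathcal{F}_I$ and $\mathcal{F}_B$ are the sets of interior and boundary facets, $\mathcal{F}=\mathcal{F}_I\cup\mathcal{F}_B$; $h_F$ denotes the size of facet $F$; $h$ denotes the mesh size; $\boldsymbol{n}$ is the outward unit normal on $\partial K$. On an interior facet shared by $K^+$ and $K^-$, superscripts $\pm$ denote traces from $K^\pm$, $\boldsymbol{n}^+=-\boldsymbol{n}^-$, the average is $\{\!\!\{q\}\!\!\}=\frac12(q^++q^-)$, and the jumps are $[\![\boldsymbol{v}]\!]=\boldsymbol{v}^+-\boldsymbol{v}^-$, $[\![\boldsymbol{v}\cdot\boldsymbol{n}]\!]=\boldsymbol{v}^+\cdot\boldsymbol{n}^++\boldsymbol{v}^-\cdot\boldsymbol{n}^-$, $[\![\boldsymbol{v}\otimes\boldsymbol{n}]\!]=\boldsymbol{v}^+\otimes\boldsymbol{n}^++\boldsymbol{v}^-\otimes\boldsymbol{n}^-$. On boundary facets, $\{\!\!\{q\}\!\!\}=q$, $[\![\boldsymbol{v}]\!]=\boldsymbol{v}$, $[\![\boldsymbol{v}\cdot\boldsymbol{n}]\!]=\boldsymbol{v}\cdot\boldsymbol{n}$, $[\![\boldsymbol{v}\otimes\boldsymbol{n}]\!]=\boldsymbol{v}\otimes\boldsymbol{n}$ and $\boldsymbol{n}^+=\boldsymbol{n}$. Spaces. $P_k(D)$ denotes polynomials of degree at most $k$ on $D$. $\boldsymbol{V}_h^k=\{\boldsymbol{v}_h\in L^2(\Omega)^d: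 \boldsymbol{v}_h|_K\in P_k(K)^d\ \forall K\in\mathcal{T}\}$; $Q_h^{k-1}=\{q_h\in L^2(\Omega): q_h|_K\in P_{k-1}(K)\ \forall K\in\mathcal{T},\ \int_\Omega q_h\,dx=0\}$; $M_h^k=\{\xi_h\in L^2(\mathcal{F}):\xi_h|_F\in P_k(F)\ \forall F\in\mathcal{F}\}$; $\mathbf{BDM}_h^k\subset\boldsymbol{V}_h^k$ is the ($H(\mathrm{div})$-conforming) Brezzi--Douglas--Marini space of order $k$, with the property $\nabla\cdot\mathbf{BDM}_h^k=Q_h^{k-1}$. Norms. $\|\cdot\|$ is the $L^2(\Omega)$ norm, $\|\cdot\|_K$ and $\|\cdot\|_F$ are the $L^2$ norms on $K$ and $F$, $\|\boldsymbol{v}\|_{1,h}^2=\sum_{K\in\mathcal{T}}\|\nabla\boldsymbol{v}\|_K^2+\sum_{F\in\mathcal{F}}\int_F h_F^{-1}|[\![\boldsymbol{v}\otimes\boldsymbol{n}]\!]|^2\,ds$, and $\|\xi\|_\lambda=\big(\sum_{F\in\mathcal{F}}h_F\|\xi\|_F^2\big)^{1/2}$. Forms. With penalty parameter $\eta>0$ (sufficiently large), $$a_h(\boldsymbol{u},\boldsymbol{v})=\sum_{K}\int_K\nabla\boldsymbol{u}:\nabla\boldsymbol{v}\,dx+\sum_{F\in\mathcal{F}}\int_F\frac{\eta}{h_F}[\![\boldsymbol{u}]\!]\cdot[\![\boldsymbol{v}]\!]\,ds-\sum_{F\in\mathcal{F}}\int_F[\![\boldsymbol{u}]\!]\otimes\boldsymbol{n}^+:\{\!\!\{\nabla\boldsymbol{v}\}\!\!\}\,ds-\sum_{F\in\mathcal{F}}\int_F[\![\boldsymbol{v}]\!]\otimes\boldsymbol{n}^+:\{\!\!\{\nabla\boldsymbol{u}\}\!\!\}\,ds,$$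 $$\tilde b_h(p,\boldsymbol{v})=-\sum_K\int_K p\,\nabla\cdot\boldsymbol{v}\,dx,\qquad b_h((p,\lambda),\boldsymbol{v})=\tilde b_h(p,\boldsymbol{v})+\sum_{F\in\mathcal{F}}\int_F[\![\boldsymbol{v}\cdot\boldsymbol{n}]\!]\,\lambda\,ds.$$ Matrices. Fix bases of $\boldsymbol{V}_h^k,Q_h^{k-1},M_h^k$, of dimensions $n_u,n_p,n_l$, and let $v\in\mathbb{R}^{n_u}$, $q\in\mathbb{R}^{n_p}$, $\xi\in\mathbb{R}^{n_l}$ be the coefficient vectors of $\boldsymbol{v}_h,q_h,\xi_h$. $A$ (symmetric), $B$, $C$, $Q$ (symmetric), $M$ (symmetric) are the matrices with $a_h(\boldsymbol{v}_h,\boldsymbol{v}_h)=v^TAv$, $b_h((q_h,0),\boldsymbol{v}_h)=q^TBv$, $b_h((0,\xi_h),\boldsymbol{v}_h)=\xi^TCv$, $\|q_h\|^2=q^TQq$, $\|\xi_h\|_\lambda^2=\xi^TM\xi$. Set $\mathcal{B}=[B^T\ C^T]^T\in\mathbb{R}^{(n_p+n_l)\times n_u}$ ($B$ stacked on top of $C$) and $\mathcal{S}=\mathcal{B}A^{-1}\mathcal{B}^T$. Two symmetric positive definite matrices (depending on $h$) are spectrally equivalent if the quotient of their quadratic forms is bounded above and below by positive constants independent of $h$.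
   Formalization: The printed lower bound is false: on a fixed mesh, as η→∞, the quotient can be O(1/η) while c_I/√c_a is of order η^(-1/2). The theorem bounds the square root of the quotient instead, i.e. c_I²/c_a ≤ qᵀSq/qᵀMq ≤ c_b²/α. *)

theory Defs
  imports
    "HOL-Analysis.Analysis"
    "Jordan_Normal_Form.Gauss_Jordan_Elimination"
begin

section \<open>Simplicial meshes\<close>

text \<open>The regular-open condition excludes slit domains, so that a facet lies on the
  boundary of \<open>\<Omega>\<close> exactly if it belongs to a single simplex.\<close>

definition simplicial_mesh :: "(real^'d) set \<Rightarrow> (real^'d) set set \<Rightarrow> bool" where
  "simplicial_mesh \<Omega> \<T> \<longleftrightarrow>
     \<T> \<noteq> {} \<and> triangulation \<T> \<and> (\<forall>K\<in>\<T>. int CARD('d) simplex K) \<and> \<Omega> = interior (\<Union>\<T>)"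

definition facets :: "(real^'d) set set \<Rightarrow> (real^'d) set set" where
  "facets \<T> = {F. \<exists>K\<in>\<T>. F facet_of K}"

definition interior_facets :: "(real^'d) set set \<Rightarrow> (real^'d) set set" where
  "interior_facets \<T> = {F. \<exists>K\<in>\<T>. \<exists>K'\<in>\<T>. K \<noteq> K' \<and> F facet_of K \<and> F facet_of K'}"

text \<open>The labelling of the two sides of a facet is an arbitrary choice \<open>kp\<close>: it assigns
  to each facet the simplex \<open>K\<^sup>+\<close>, which on a boundary facet is the only adjacent simplex.\<close>

definition facet_labelling :: "(real^'d) set set \<Rightarrow> ((real^'d) set \<Rightarrow> (real^'d) set) \<Rightarrow> bool" where
  "facet_labelling \<T> kp \<longleftrightarrow> (\<forall>F\<in>facets \<T>. kp F \<in> \<T> \<and> F facet_of kp F)"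

definition minus_side ::
    "(real^'d) set set \<Rightarrow> ((real^'d) set \<Rightarrow> (real^'d) set) \<Rightarrow> (real^'d) set \<Rightarrow> (real^'d) set" where
  "minus_side \<T> kp F = (THE K. K \<in> \<T> \<and> F facet_of K \<and> K \<noteq> kp F)"

definition outward_normal :: "(real^'d) set \<Rightarrow> (real^'d) set \<Rightarrow> real^'d" where
  "outward_normal K F =
     (THE n. norm n = 1 \<and> (\<exists>c. (\<forall>x\<in>F. inner n x = c) \<and> (\<forall>x\<in>K. inner n x \<le> c)))"

text \<open>The surface measure \<open>ds\<close> on a flat facet \<open>F\<close>: by Fubini, the area of \<open>A \<subseteq> F\<close> is the
  volume of the right prism of height 1 over \<open>A\<close>. Hence \<open>ds\<close> is the image of Lebesgue measure
  on the unit prism over \<open>F\<close> under the orthogonal projection onto the hyperplane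
  \<open>n \<sqdot> x = c\<close> containing \<open>F\<close>. The choice of the sign of \<open>n\<close> is immaterial.\<close>

definition surface_measure :: "(real^'d) set \<Rightarrow> (real^'d) measure" where
  "surface_measure F =
     (let (n, c) = (SOME (n, c). norm n = 1 \<and> (\<forall>x\<in>F. inner n x = c)) in
      distr (restrict_space lborel {x + t *\<^sub>R n | x t. x \<in> F \<and> t \<in> {0..1}}) borel
        (\<lambda>y. y - (inner n y - c) *\<^sub>R n))"

section \<open>Broken polynomial spaces\<close>

text \<open>\<open>P\<^sub>k(D)\<close>: polynomial functions of total degree at most \<open>k\<close> on \<open>D\<close>, extended by \<open>0\<close>
  outside \<open>D\<close> so that equality of functions is equality on \<open>D\<close>.\<close>

definition polys :: "nat \<Rightarrow> (real^'d) set \<Rightarrow> (real^'d \<Rightarrow> real) set" where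
  "polys k D = {f. \<exists>c :: ('d \<Rightarrow> nat) \<Rightarrow> real. \<forall>x.
     f x = (if x \<in> D then \<Sum>\<alpha> | sum \<alpha> UNIV \<le> k. c \<alpha> * (\<Prod>i\<in>UNIV. (x $ i) ^ \<alpha> i) else 0)}"

text \<open>An element of \<open>L\<^sup>2(\<Omega>)\<close> (or of \<open>L\<^sup>2(\<F>)\<close>) that is piecewise polynomial is given by the
  family of its polynomial pieces, indexed by the cells (or facets). The pieces are defined on
  the closed cells; thus the trace of \<open>v\<close> from \<open>K\<close> on a facet of \<open>K\<close> is \<open>v K\<close>.\<close>

type_synonym ('d, 'b) broken = "(real^'d) set \<Rightarrow> real^'d \<Rightarrow> 'b"

definition V_space :: "(real^'d) set set \<Rightarrow> nat \<Rightarrow> ('d, real^'d) broken set" where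
  "V_space \<T> k = {v. (\<forall>K\<in>\<T>. \<forall>i. (\<lambda>x. v K x $ i) \<in> polys k K) \<and> (\<forall>K. K \<notin> \<T> \<longrightarrow> v K = (\<lambda>_. 0))}"

definition Q_space :: "(real^'d) set set \<Rightarrow> nat \<Rightarrow> ('d, real) broken set" where
  "Q_space \<T> m = {q. (\<forall>K\<in>\<T>. q K \<in> polys m K) \<and> (\<forall>K. K \<notin> \<T> \<longrightarrow> q K = (\<lambda>_. 0)) \<and>
     (\<Sum>K\<in>\<T>. LINT x:K|lborel. q K x) = 0}"

definition M_space :: "(real^'d) set set \<Rightarrow> nat \<Rightarrow> ('d, real) broken set" where
  "M_space \<T> k = {\<xi>. (\<forall>F\<in>facets \<T>. \<xi> F \<in> polys k F) \<and> (\<forall>F. F \<notin> facets \<T> \<longrightarrow> \<xi> F = (\<lambda>_. 0))}"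

section \<open>Jumps and averages\<close>

definition outer :: "real^'d \<Rightarrow> real^'d \<Rightarrow> real^'d^'d" (infixl "\<otimes>\<^bsub>v\<^esub>" 75) where
  "u \<otimes>\<^bsub>v\<^esub> w = (\<chi> i j. u $ i * w $ j)"

definition grad :: "('d, real^'d) broken \<Rightarrow> ('d, real^'d^'d) broken" where
  "grad v K x = jacobian (v K) (at x within K)"

definition divergence :: "('d, real^'d) broken \<Rightarrow> ('d, real) broken" where
  "divergence v K x = trace (grad v K x)"

context
  fixes \<T> :: "(real^'d) set set" and kp :: "(real^'d) set \<Rightarrow> (real^'d) set"
begin

definition normal_plus :: "(real^'d) set \<Rightarrow> real^'d" where
  "normal_plus F = outward_normal (kp F) F"

definition normal_minus :: "(real^'d) set \<Rightarrow> real^'d" where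
  "normal_minus F = outward_normal (minus_side \<T> kp F) F"

definition average :: "('d, 'b::real_vector) broken \<Rightarrow> ('d, 'b) broken" where
  "average q F x = (if F \<in> interior_facets \<T>
     then (1/2) *\<^sub>R (q (kp F) x + q (minus_side \<T> kp F) x) else q (kp F) x)"

definition jump :: "('d, real^'d) broken \<Rightarrow> ('d, real^'d) broken" where
  "jump v F x = (if F \<in> interior_facets \<T>
     then v (kp F) x - v (minus_side \<T> kp F) x else v (kp F) x)"

definition jump_normal :: "('d, real^'d) broken \<Rightarrow> ('d, real) broken" where
  "jump_normal v F x = (if F \<in> interior_facets \<T>
     then inner (v (kp F) x) (normal_plus F) + inner (v (minus_side \<T> kp F) x) (normal_minus F)
     else inner (v (kp F) x) (normal_plus F))"

definition jump_tensor :: "('d, real^'d) broken \<Rightarrow> ('d, real^'d^'d) broken" where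
  "jump_tensor v F x = (if F \<in> interior_facets \<T>
     then v (kp F) x \<otimes>\<^bsub>v\<^esub> normal_plus F + v (minus_side \<T> kp F) x \<otimes>\<^bsub>v\<^esub> normal_minus F
     else v (kp F) x \<otimes>\<^bsub>v\<^esub> normal_plus F)"

text \<open>\<open>H(div)\<close>-conformity of a broken polynomial is continuity of its normal component across
  interior facets. The boundary facets are included because the divergence of the space is
  \<open>Q_space\<close>, whose elements have mean value zero: the normal component vanishes on \<open>\<partial>\<Omega>\<close>.\<close>

definition BDM_space :: "nat \<Rightarrow> ('d, real^'d) broken set" where
  "BDM_space k = {v \<in> V_space \<T> k. \<forall>F\<in>facets \<T>. \<forall>x\<in>F. jump_normal v F x = 0}"

section \<open>Norms and forms\<close>

text \<open>The size \<open>h\<^sub>F\<close> is the diameter of \<open>F\<close>. On \<open>real^'d^'d\<close>, \<open>inner\<close> is the Frobenius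
  product and \<open>norm\<close> the Frobenius norm.\<close>

definition dg_norm :: "('d, real^'d) broken \<Rightarrow> real" where
  "dg_norm v = sqrt
     ((\<Sum>K\<in>\<T>. LINT x:K|lborel. (norm (grad v K x))\<^sup>2) +
      (\<Sum>F\<in>facets \<T>. LINT x:F|surface_measure F. inverse (diameter F) * (norm (jump_tensor v F x))\<^sup>2))"

definition l2_norm :: "('d, real) broken \<Rightarrow> real" where
  "l2_norm q = sqrt (\<Sum>K\<in>\<T>. LINT x:K|lborel. (q K x)\<^sup>2)"

definition lambda_norm :: "('d, real) broken \<Rightarrow> real" where
  "lambda_norm \<xi> = sqrt (\<Sum>F\<in>facets \<T>. diameter F * (LINT x:F|surface_measure F. (\<xi> F x)\<^sup>2))"

definition a_form :: "real \<Rightarrow> ('d, real^'d) broken \<Rightarrow> ('d, real^'d) broken \<Rightarrow> real" where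
  "a_form \<eta> u v =
     (\<Sum>K\<in>\<T>. LINT x:K|lborel. inner (grad u K x) (grad v K x))
   + (\<Sum>F\<in>facets \<T>. LINT x:F|surface_measure F.
        \<eta> / diameter F * inner (jump u F x) (jump v F x))
   - (\<Sum>F\<in>facets \<T>. LINT x:F|surface_measure F.
        inner (jump u F x \<otimes>\<^bsub>v\<^esub> normal_plus F) (average (grad v) F x))
   - (\<Sum>F\<in>facets \<T>. LINT x:F|surface_measure F.
        inner (jump v F x \<otimes>\<^bsub>v\<^esub> normal_plus F) (average (grad u) F x))"

definition b_tilde :: "('d, real) broken \<Rightarrow> ('d, real^'d) broken \<Rightarrow> real" where
  "b_tilde p v = - (\<Sum>K\<in>\<T>. LINT x:K|lborel. p K x * divergence v K x)"

definition b_facet :: "('d, real) broken \<Rightarrow> ('d, real^'d) broken \<Rightarrow> real" where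
  "b_facet \<xi> v = (\<Sum>F\<in>facets \<T>. LINT x:F|surface_measure F. jump_normal v F x * \<xi> F x)"

definition b_form :: "('d, real) broken \<times> ('d, real) broken \<Rightarrow> ('d, real^'d) broken \<Rightarrow> real" where
  "b_form = (\<lambda>(p, \<xi>) v. b_tilde p v + b_facet \<xi> v)"

text \<open>The supremum is taken in the extended reals, where it always exists.\<close>

definition sup_quotient :: "('d, real^'d) broken set \<Rightarrow> (('d, real^'d) broken \<Rightarrow> real) \<Rightarrow> ereal" where
  "sup_quotient W f = (SUP w \<in> W - {\<lambda>_ _. 0}. ereal (f w / dg_norm w))"

end

section \<open>Coefficient vectors and matrices\<close>

text \<open>The dimensions depend on the mesh, hence vectors and matrices with explicit dimensions.\<close>

definition from_coeffs :: "(nat \<Rightarrow> ('d, 'b::real_vector) broken) \<Rightarrow> real vec \<Rightarrow> ('d, 'b) broken" where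
  "from_coeffs \<phi> c = (\<lambda>S x. \<Sum>i<dim_vec c. (c $ i) *\<^sub>R \<phi> i S x)"

definition is_basis ::
    "nat \<Rightarrow> (nat \<Rightarrow> ('d, 'b::real_vector) broken) \<Rightarrow> ('d, 'b) broken set \<Rightarrow> bool" where
  "is_basis n \<phi> W \<longleftrightarrow>
     (\<forall>i<n. \<phi> i \<in> W) \<and>
     (\<forall>c\<in>carrier_vec n. from_coeffs \<phi> c = (\<lambda>_ _. 0) \<longrightarrow> c = 0\<^sub>v n) \<and>
     (\<forall>v\<in>W. \<exists>c\<in>carrier_vec n. v = from_coeffs \<phi> c)"

definition quadratic_form_matrix ::
    "nat \<Rightarrow> (nat \<Rightarrow> ('d, 'b::real_vector) broken) \<Rightarrow> (('d, 'b) broken \<Rightarrow> real) \<Rightarrow> real mat \<Rightarrow> bool" where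
  "quadratic_form_matrix n \<phi> f X \<longleftrightarrow>
     X \<in> carrier_mat n n \<and> transpose_mat X = X \<and>
     (\<forall>c\<in>carrier_vec n. f (from_coeffs \<phi> c) = scalar_prod c (X *\<^sub>v c))"

definition bilinear_form_matrix ::
    "nat \<Rightarrow> (nat \<Rightarrow> ('d, 'a::real_vector) broken) \<Rightarrow> nat \<Rightarrow> (nat \<Rightarrow> ('d, 'b::real_vector) broken) \<Rightarrow>
     (('d, 'a) broken \<Rightarrow> ('d, 'b) broken \<Rightarrow> real) \<Rightarrow> real mat \<Rightarrow> bool" where
  "bilinear_form_matrix m \<psi> n \<phi> f X \<longleftrightarrow>
     X \<in> carrier_mat m n \<and>
     (\<forall>q\<in>carrier_vec m. \<forall>v\<in>carrier_vec n.
        f (from_coeffs \<psi> q) (from_coeffs \<phi> v) = scalar_prod q (X *\<^sub>v v))"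

text \<open>\<open>mat_inverse A\<close> is \<open>Some A\<^sup>-\<^sup>1\<close> if \<open>A\<close> is invertible.\<close>

definition schur_complement :: "real mat \<Rightarrow> real mat \<Rightarrow> real mat" where
  "schur_complement A B = B * the (mat_inverse A) * transpose_mat B"

definition spd :: "nat \<Rightarrow> real mat \<Rightarrow> bool" where
  "spd n X \<longleftrightarrow> X \<in> carrier_mat n n \<and> transpose_mat X = X \<and>
     (\<forall>x\<in>carrier_vec n. x \<noteq> 0\<^sub>v n \<longrightarrow> 0 < scalar_prod x (X *\<^sub>v x))"

text \<open>Spectral equivalence of two families of matrices, indexed by the mesh.\<close>

definition spectrally_equivalent :: "('i \<Rightarrow> nat) \<Rightarrow> ('i \<Rightarrow> real mat) \<Rightarrow> ('i \<Rightarrow> real mat) \<Rightarrow> bool" where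
  "spectrally_equivalent n X Y \<longleftrightarrow>
     (\<forall>i. spd (n i) (X i) \<and> spd (n i) (Y i)) \<and>
     (\<exists>c>0. \<exists>C>0. \<forall>i. \<forall>x\<in>carrier_vec (n i). x \<noteq> 0\<^sub>v (n i) \<longrightarrow>
        c \<le> scalar_prod x (X i *\<^sub>v x) / scalar_prod x (Y i *\<^sub>v x) \<and>
        scalar_prod x (X i *\<^sub>v x) / scalar_prod x (Y i *\<^sub>v x) \<le> C)"

end

theory Submission
  imports Defs "Jordan_Normal_Form.Determinant"
begin

text \<open>
  If \<open>A\<close> is positive definite, then \<open>x\<^sup>T S x\<close> is the square of the dual norm of the functional
  \<open>v \<mapsto> x\<^sup>T B v\<close> with respect to the inner product of \<open>A\<close>. Coercivity and boundedness of \<open>a\<^sub>h\<close>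
  compare the norm of \<open>A\<close> with the discrete \<open>H\<^sup>1\<close> norm, so the boundedness of \<open>b\<^sub>h\<close> bounds
  \<open>x\<^sup>T S x\<close> from above and the inf-sup condition bounds it from below; the weights in the
  preconditioner are chosen so that its form is
  \<open>(\<beta>\<^sup>2 \<parallel>q\<parallel>\<^sup>2 + \<beta>\<^sub>\<lambda>\<^sup>2 \<parallel>\<xi>\<parallel>\<^sup>2) / min (\<beta>\<^sup>2) (\<beta>\<^sub>\<lambda>\<^sup>2)\<close>.

  The positive definiteness of \<open>A\<close> is a Poincare-type statement about the mesh: a broken
  polynomial of discrete norm zero is constant on each cell, has no jumps, and vanishes next to
  the boundary. Each facet of a cell in its support is therefore shared with another cell in
  its support, which is impossible for a nonempty finite set of cells since their union is
  bounded.
\<close>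

section \<open>Facets of simplicial meshes\<close>

lemma aff_dim_full_imp_interior:
  fixes S :: "'a::euclidean_space set"
  assumes "convex S" "aff_dim S = int DIM('a)"
  shows "interior S \<noteq> {}"
proof -
  have "affine hull S = UNIV"
    using assms(2) by (simp add: aff_dim_eq_full)
  then have "rel_interior S = interior S"
    by (rule rel_interior_interior)
  moreover have "S \<noteq> {}"
    using assms(2) by auto
  ultimately show ?thesis
    using assms(1) rel_interior_eq_empty by blast
qed

lemma negligible_aff_dim_less:
  fixes S :: "'a::euclidean_space set"
  assumes "aff_dim S < int DIM('a)"
  shows "negligible (affine hull S)"
proof -
  have "interior (affine hull S) = {}"
    using assms aff_dim_nonempty_interior[of "affine hull S"] by force
  then show ?thesis
    by (simp add: negligible_convex_interior affine_imp_convex)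
qed

text \<open>Faces of a polytope are exposed. The exposing functional cannot vanish, since otherwise
  F would be empty or all of K, against the dimension of a facet; so it can be normalised.\<close>

lemma facet_supporting_hyperplane:
  fixes K :: "'a::euclidean_space set"
  assumes "polytope K" "aff_dim K = int DIM('a)" "F facet_of K"
  obtains n c where "norm n = 1" "F = K \<inter> {x. inner n x = c}" "K \<subseteq> {x. inner n x \<le> c}"
proof -
  have face: "F face_of K" and F: "F \<noteq> {}" "aff_dim F = aff_dim K - 1"
    using assms(3) by (auto simp: facet_of_def)
  then have "F exposed_face_of K"
    using exposed_face_of_polyhedron assms(1) polytope_imp_polyhedron by blast
  then obtain a b where ab: "K \<subseteq> {x. inner a x \<le> b}" "F = K \<inter> {x. inner a x = b}"
    by (auto simp: exposed_face_of_def)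
  have "a \<noteq> 0"
  proof
    assume "a = 0"
    then have "F = K \<or> F = {}" using ab by auto
    then show False using F by auto
  qed
  then have na: "norm a > 0" by simp
  show thesis
  proof
    show "norm (a /\<^sub>R norm a) = 1" using na by simp
    show "F = K \<inter> {x. inner (a /\<^sub>R norm a) x = b / norm a}"
      using ab(2) na by (auto simp: field_simps)
    show "K \<subseteq> {x. inner (a /\<^sub>R norm a) x \<le> b / norm a}"
      using ab(1) na by (auto simp: field_simps)
  qed
qed

text \<open>By dimension, the affine hull of F is the whole hyperplane normal to n. Moving inside it
  by w, the component of m orthogonal to n, leaves \<open>inner m\<close> unchanged; so w is
  orthogonal to both m and n, hence to itself.\<close>

lemma unit_normal_unique:
  fixes F :: "'a::euclidean_space set"
  assumes "aff_dim F = int DIM('a) - 1" "F \<noteq> {}" "norm n = 1" "norm m = 1"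
    and "F \<subseteq> {x. inner n x = c}" "F \<subseteq> {x. inner m x = e}"
  shows "m = n \<or> m = - n"
proof -
  have n0: "n \<noteq> 0" using assms(3) by auto
  have "affine hull F \<subseteq> {x. inner n x = c}"
    by (intro hull_minimal assms(5) affine_hyperplane)
  moreover have "aff_dim {x. inner n x = c} = int DIM('a) - 1"
    using n0 by (simp add: aff_dim_hyperplane)
  ultimately have hF: "affine hull F = {x. inner n x = c}"
    using affine_dim_equal[of "affine hull F" "{x. inner n x = c}"] assms(1,2)
    by (simp add: affine_hyperplane)
  have sub: "affine hull F \<subseteq> {x. inner m x = e}"
    by (intro hull_minimal assms(6) affine_hyperplane)
  have nn: "inner n n = 1" and mm: "inner m m = 1"
    using assms(3,4) by (simp_all add: dot_square_norm)
  define w where "w = m - inner n m *\<^sub>R n"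
  have nw: "inner n w = 0"
    by (simp add: w_def inner_diff_right nn)
  have "c *\<^sub>R n \<in> affine hull F" "c *\<^sub>R n + w \<in> affine hull F"
    using hF nn nw by (auto simp: inner_add_right)
  then have "inner m (c *\<^sub>R n) = e" "inner m (c *\<^sub>R n + w) = e"
    using sub by auto
  then have mw: "inner m w = 0" by (simp add: inner_add_right)
  have "inner w w = inner m w - inner n m * inner n w"
    by (subst (1) w_def) (simp add: inner_diff_left)
  then have "w = 0" using nw mw by simp
  then have m: "m = inner n m *\<^sub>R n" by (simp add: w_def)
  then have "norm m = \<bar>inner n m\<bar> * norm n" by (metis norm_scaleR)
  then have "\<bar>inner n m\<bar> = 1" using assms(3,4) by simp
  then have "inner n m = 1 \<or> inner n m = -1" by linarith
  then show ?thesis using m by (metis scaleR_one scaleR_minus1_left)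
qed

text \<open>The other facets form a closed set missing x, so a small ball avoids them. The open half
  ball in it is connected, avoids the frontier of K and contains an interior point of K, hence lies
  in K. Taking closures adds the flat side.\<close>

lemma polytope_half_ball_at_facet:
  fixes K :: "'a::euclidean_space set"
  assumes K: "polytope K" "aff_dim K = int DIM('a)" and F: "F facet_of K"
    and n: "n \<noteq> 0" "F \<subseteq> {x. inner n x = c}" "K \<subseteq> {x. inner n x \<le> c}"
    and x: "x \<in> F" "\<And>F'. F' facet_of K \<Longrightarrow> x \<in> F' \<Longrightarrow> F' = F"
  obtains e where "0 < e" "ball x e \<inter> {y. inner n y \<le> c} \<subseteq> K"
proof -
  have conv: "convex K" and closed: "closed K" and poly: "polyhedron K"
    using K(1) polytope_imp_convex polytope_imp_closed polytope_imp_polyhedron by auto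
  have ne: "interior K \<noteq> {}" using aff_dim_full_imp_interior conv K(2) by blast
  define R where "R = \<Union>{F'. F' facet_of K \<and> F' \<noteq> F}"
  have "finite {F'. F' facet_of K \<and> F' \<noteq> F}"
    using finite_polytope_facets[OF K(1)] by (rule rev_finite_subset) auto
  moreover have "closed F'" if "F' facet_of K" for F'
    using that face_of_imp_closed[OF conv closed] by (auto simp: facet_of_def)
  ultimately have "closed R" unfolding R_def by (intro closed_Union) auto
  moreover have "x \<notin> R" using x(2) by (auto simp: R_def)
  ultimately have "open (- R)" "x \<in> - R" by auto
  then obtain e where e: "0 < e" "ball x e \<subseteq> - R" using openE by blast
  define S where "S = ball x e \<inter> {y. inner n y < c}"
  have "rel_frontier K = frontier K"
    using ne by (simp add: rel_frontier_nonempty_interior)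
  \<comment> \<open>The frontier of a full-dimensional polytope is the union of its facets, so only
    F and the closed set R have to be avoided.\<close>
  then have "frontier K = \<Union>{F. F facet_of K}"
    using rel_frontier_of_polyhedron[OF poly] by simp
  then have fr: "frontier K \<subseteq> F \<union> R" by (auto simp: R_def)
  have "convex S" unfolding S_def by (intro convex_Int convex_ball convex_halfspace_lt)
  then have con: "connected S" by (rule convex_connected)
  have "S \<inter> F = {}" "S \<inter> R = {}" using n(2) e(2) by (auto simp: S_def)
  then have disj: "S \<inter> frontier K = {}" using fr by auto
  have "x \<in> K" using x(1) F facet_of_imp_subset by blast
  then have "x \<in> closure (interior K)"
    using convex_closure_interior[OF conv ne] closed by simp
  then obtain z where z: "z \<in> interior K" "dist z x < e"
    using e(1) closure_approachable by blast
  have "interior K \<subseteq> interior {x. inner n x \<le> c}" by (intro interior_mono n(3))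
  then have "inner n z < c" using z(1) n(1) by (auto simp: interior_halfspace_le)
  then have "z \<in> S \<inter> K" using z interior_subset by (auto simp: S_def dist_commute)
  then have "S \<subseteq> K" using connected_Int_frontier[OF con] disj by blast
  then have "closure S \<subseteq> K" using closed by (simp add: closure_minimal)
  moreover have "ball x e \<inter> closure {y. inner n y < c} \<subseteq> closure S"
    unfolding S_def by (rule open_Int_closure_subset) simp
  ultimately have "ball x e \<inter> {y. inner n y \<le> c} \<subseteq> K"
    using n(1) by (simp add: closure_halfspace_lt)
  then show thesis using e(1) that by blast
qed

lemma facet_eq_if_subset:
  fixes K :: "'a::euclidean_space set"
  assumes "convex K" "F facet_of K" "F' facet_of K" "F \<subseteq> F'"
  shows "F = F'"
proof (rule ccontr)
  assume "F \<noteq> F'"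
  have F: "F face_of K" "aff_dim F = aff_dim K - 1" and F': "F' face_of K" "aff_dim F' = aff_dim K - 1"
    using assms(2,3) by (auto simp: facet_of_def)
  have "F face_of F'"
    using F(1) F'(1) assms(4) face_of_subset face_of_imp_subset by blast
  moreover have "convex F'" using F'(1) face_of_imp_convex by blast
  ultimately have "aff_dim F < aff_dim F'"
    using face_of_aff_dim_lt \<open>F \<noteq> F'\<close> by blast
  then show False using F(2) F'(2) by simp
qed

lemma facet_through_rel_interior:
  fixes K :: "'a::euclidean_space set"
  assumes "convex K" "F facet_of K" "F' facet_of K" "x \<in> rel_interior F" "x \<in> F'"
  shows "F' = F"
proof -
  have "F \<subseteq> F'"
    by (rule subset_of_face_of[of F' K])
      (use assms facet_of_imp_subset in \<open>auto simp: facet_of_def\<close>)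
  then show ?thesis using facet_eq_if_subset assms(1-3) by blast
qed

text \<open>A proper face of F has smaller dimension than F. Codimension two is what allows a
  generic segment to miss all such intersections in \<open>no_closed_subcomplex\<close>.\<close>

lemma facet_Int_aff_dim:
  fixes K :: "'a::euclidean_space set"
  assumes "convex K" "F facet_of K" "F' facet_of K" "F \<noteq> F'"
  shows "aff_dim (F \<inter> F') \<le> aff_dim K - 2"
proof -
  have F: "F face_of K" "aff_dim F = aff_dim K - 1" and F': "F' face_of K"
    using assms(2,3) by (auto simp: facet_of_def)
  have "F \<inter> F' face_of K" using F(1) F' by (rule face_of_Int)
  then have "F \<inter> F' face_of F"
    using F(1) face_of_imp_subset face_of_subset by blast
  moreover have "F \<inter> F' \<noteq> F"
    using facet_eq_if_subset[OF assms(1-3)] assms(4) by blast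
  moreover have "convex F" using F(1) face_of_imp_convex by blast
  ultimately have "aff_dim (F \<inter> F') < aff_dim F"
    using face_of_aff_dim_lt by blast
  then show ?thesis using F(2) by simp
qed

section \<open>Cells sharing a facet, and subcomplexes without boundary facets\<close>

context
  fixes \<Omega> :: "(real^'d) set" and \<T> :: "(real^'d) set set"
  assumes mesh: "simplicial_mesh \<Omega> \<T>"
begin

lemma finite_mesh: "finite \<T>"
  using mesh by (auto simp: simplicial_mesh_def triangulation_def)

lemma mesh_cell:
  assumes "K \<in> \<T>"
  shows "polytope K" "aff_dim K = int DIM(real^'d)" "convex K" "compact K" "closed K" "interior K \<noteq> {}"
proof -
  have s: "int CARD('d) simplex K" using mesh assms by (auto simp: simplicial_mesh_def)
  show "polytope K" using s by (rule simplex_imp_polytope)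
  show "aff_dim K = int DIM(real^'d)" using aff_dim_simplex[OF s] by simp
  show "convex K" "compact K" "closed K"
    using s convex_simplex compact_simplex closed_simplex by auto
  then show "interior K \<noteq> {}"
    using aff_dim_full_imp_interior \<open>aff_dim K = int DIM(real^'d)\<close> by blast
qed

lemma mesh_facet:
  assumes "K \<in> \<T>" "F facet_of K"
  shows "aff_dim F = int DIM(real^'d) - 1" "F \<noteq> {}" "convex F" "compact F" "F \<subseteq> K"
proof -
  have F: "F face_of K" using assms(2) by (auto simp: facet_of_def)
  show "aff_dim F = int DIM(real^'d) - 1" "F \<noteq> {}"
    using assms(2) mesh_cell(2)[OF assms(1)] by (auto simp: facet_of_def)
  show "convex F" using F face_of_imp_convex by blast
  show "compact F" using F face_of_imp_compact mesh_cell[OF assms(1)] by blast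
  show "F \<subseteq> K" using F face_of_imp_subset by blast
qed

lemma finite_facets: "finite (facets \<T>)"
proof -
  have "facets \<T> = (\<Union>K\<in>\<T>. {F. F facet_of K})" by (auto simp: facets_def)
  then show ?thesis
    using finite_mesh finite_polytope_facets[OF mesh_cell(1)] by auto
qed

text \<open>At a relative interior point of F both cells contain a half ball on the same side, so
  their interiors meet. In a triangulation the intersection is a face of each cell, and a face that
  meets the interior is the whole cell.\<close>

lemma same_side_cells_eq:
  assumes K: "K \<in> \<T>" "F facet_of K" "K \<subseteq> {x. inner n x \<le> c}"
    and K': "K' \<in> \<T>" "F facet_of K'" "K' \<subseteq> {x. inner n x \<le> c}"
    and F: "F \<subseteq> {x. inner n x = c}" and n: "n \<noteq> 0"
  shows "K = K'"
proof -
  have "rel_interior F \<noteq> {}"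
    using mesh_facet[OF K(1,2)] by (simp add: rel_interior_eq_empty)
  then obtain x where x: "x \<in> rel_interior F" by blast
  then have xF: "x \<in> F" using rel_interior_subset by blast
  obtain e where e: "0 < e" "ball x e \<inter> {y. inner n y \<le> c} \<subseteq> K"
    using polytope_half_ball_at_facet[OF mesh_cell(1,2)[OF K(1)] K(2) n F K(3) xF]
      facet_through_rel_interior[OF mesh_cell(3)[OF K(1)] K(2) _ x] by blast
  obtain e' where e': "0 < e'" "ball x e' \<inter> {y. inner n y \<le> c} \<subseteq> K'"
    using polytope_half_ball_at_facet[OF mesh_cell(1,2)[OF K'(1)] K'(2) n F K'(3) xF]
      facet_through_rel_interior[OF mesh_cell(3)[OF K'(1)] K'(2) _ x] by blast
  define D where "D = ball x e \<inter> ball x e' \<inter> {y. inner n y < c}"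
  have "open D" unfolding D_def by (intro open_Int open_ball open_halfspace_lt)
  have "D \<subseteq> K" "D \<subseteq> K'" using e(2) e'(2) by (auto simp: D_def)
  then have int: "D \<subseteq> interior K" "D \<subseteq> interior K'"
    using \<open>open D\<close> by (auto intro: interiorI)
  have "x \<in> closure {y. inner n y < c}" using xF F n by (auto simp: closure_halfspace_lt)
  then obtain y where "y \<in> {y. inner n y < c}" "dist y x < min e e'"
    using e(1) e'(1) closure_approachable[of x] by (metis min_less_iff_conj)
  then have y: "y \<in> D" by (auto simp: D_def dist_commute)
  have "K \<inter> K' face_of K" "K' \<inter> K face_of K'"
    using mesh K(1) K'(1) by (auto simp: simplicial_mesh_def triangulation_def)
  then have "K \<inter> K' = K" "K' \<inter> K = K'"
    using face_of_disjoint_interior y int \<open>D \<subseteq> K\<close> \<open>D \<subseteq> K'\<close> by blast+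
  then show ?thesis by blast
qed

text \<open>This resolves the definite description in \<open>outward_normal\<close>. Only the two
  signs of n compete, and -n would squeeze K into a hyperplane, contradicting its full
  dimension.\<close>

lemma outward_normal_eq:
  assumes K: "K \<in> \<T>" "F facet_of K"
    and n: "norm n = 1" "F \<subseteq> {x. inner n x = c}" "K \<subseteq> {x. inner n x \<le> c}"
  shows "outward_normal K F = n"
  unfolding outward_normal_def
proof (rule the_equality)
  show "norm n = 1 \<and> (\<exists>c. (\<forall>x\<in>F. inner n x = c) \<and> (\<forall>x\<in>K. inner n x \<le> c))"
    using n by blast
  fix m assume "norm m = 1 \<and> (\<exists>c. (\<forall>x\<in>F. inner m x = c) \<and> (\<forall>x\<in>K. inner m x \<le> c))"
  then obtain e where m: "norm m = 1" "\<forall>x\<in>F. inner m x = e" "\<forall>x\<in>K. inner m x \<le> e" by blast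
  have "m = n \<or> m = - n"
    by (rule unit_normal_unique[of F n m c e])
      (use mesh_facet[OF K] n m in auto)
  moreover have "m \<noteq> - n"
  proof
    assume mn: "m = - n"
    obtain y where y: "y \<in> F" using mesh_facet(2)[OF K] by blast
    then have "e = - c" using m(2) n(2) mn by auto
    then have "K \<subseteq> {x. inner n x = c}" using m(3) n(3) mn by fastforce
    then have "aff_dim K \<le> aff_dim {x. inner n x = c}" by (rule aff_dim_subset)
    moreover have "n \<noteq> 0" using n(1) by auto
    ultimately show False using mesh_cell(2)[OF K(1)] by (simp add: aff_dim_hyperplane)
  qed
  ultimately show "m = n" by blast
qed

text \<open>The supporting normal of the second cell is n or -n. The sign + would put both cells on
  the same side of F and make them equal.\<close>

lemma opposite_side:
  assumes K: "K \<in> \<T>" "F facet_of K" "F \<subseteq> {x. inner n x = c}" "K \<subseteq> {x. inner n x \<le> c}"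
    and n: "norm n = 1"
    and K': "K' \<in> \<T>" "F facet_of K'" "K' \<noteq> K"
  shows "K' \<subseteq> {x. inner (- n) x \<le> - c}" "outward_normal K' F = - n"
proof -
  have n0: "n \<noteq> 0" using n by auto
  obtain m e where m: "norm m = 1" "F = K' \<inter> {x. inner m x = e}" "K' \<subseteq> {x. inner m x \<le> e}"
    using facet_supporting_hyperplane[OF mesh_cell(1,2)[OF K'(1)] K'(2)] .
  obtain y where y: "y \<in> F" using mesh_facet(2)[OF K(1,2)] by blast
  have "m = n \<or> m = - n"
    by (rule unit_normal_unique[of F n m c e])
      (use mesh_facet[OF K(1,2)] n m K(3) in auto)
  moreover have "m \<noteq> n"
  proof
    assume "m = n"
    then have "e = c" using y m(2) K(3) by auto
    then show False
      using same_side_cells_eq[OF K(1,2,4) K'(1,2) _ K(3) n0] m(3) \<open>m = n\<close> K'(3) by blast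
  qed
  ultimately have mn: "m = - n" by blast
  then have "e = - c" using y m(2) K(3) by auto
  then show "K' \<subseteq> {x. inner (- n) x \<le> - c}" using m(3) mn by simp
  show "outward_normal K' F = - n"
    using outward_normal_eq[OF K'(1,2), of "- n" "e"] m mn by auto
qed

text \<open>Two cells different from K both lie across F from K, hence on the same side as each
  other.\<close>

lemma at_most_two_cells:
  assumes "K \<in> \<T>" "F facet_of K" "K' \<in> \<T>" "F facet_of K'" "K' \<noteq> K"
    "K'' \<in> \<T>" "F facet_of K''" "K'' \<noteq> K"
  shows "K' = K''"
proof -
  obtain n c where n: "norm n = 1" "F = K \<inter> {x. inner n x = c}" "K \<subseteq> {x. inner n x \<le> c}"
    using facet_supporting_hyperplane[OF mesh_cell(1,2)[OF assms(1)] assms(2)] .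
  have F: "F \<subseteq> {x. inner n x = c}" using n(2) by blast
  have "F \<subseteq> {x. inner (- n) x = - c}" "- n \<noteq> 0" using F n(1) by auto
  then show ?thesis
    using same_side_cells_eq[of K' F "- n" "- c" K'']
      opposite_side(1)[OF assms(1,2) F n(3,1)] assms by blast
qed

text \<open>Start from a point of a cell of the subcomplex and walk to a point outside along a
  segment that avoids all intersections of two facets of a cell: it can only leave the
  subcomplex through the relative interior of a facet, where the neighbour takes over.\<close>

lemma no_closed_subcomplex:
  assumes sub: "\<T>' \<subseteq> \<T>"
    and nb: "\<And>K F. K \<in> \<T>' \<Longrightarrow> F facet_of K \<Longrightarrow> \<exists>K'\<in>\<T>'. K' \<noteq> K \<and> F facet_of K'"
  shows "\<T>' = {}"
proof (rule ccontr)
  assume "\<T>' \<noteq> {}"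
  then obtain K0 where K0: "K0 \<in> \<T>'" by blast
  have fin: "finite \<T>'" using sub finite_mesh finite_subset by blast
  \<comment> \<open>Z collects the intersections of two distinct facets of a cell. A point of the
    subcomplex outside the union of Z lies on at most one facet of each of its cells.\<close>
  define Z where "Z = (\<Union>K\<in>\<T>'. (\<lambda>(F, F'). F \<inter> F') `
    {(F, F'). F facet_of K \<and> F' facet_of K \<and> F \<noteq> F'})"
  have "finite {(F, F'). F facet_of K \<and> F' facet_of K \<and> F \<noteq> F'}" if "K \<in> \<T>'" for K
  proof (rule finite_subset)
    show "finite ({F. F facet_of K} \<times> {F. F facet_of K})"
      using that sub finite_polytope_facets mesh_cell(1) by blast
  qed auto
  then have finZ: "finite Z" unfolding Z_def using fin by blast
  have dimZ: "aff_dim z \<le> int DIM(real^'d) - 2" if z: "z \<in> Z" for z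
  proof -
    obtain K F F' where "K \<in> \<T>'" "F facet_of K" "F' facet_of K" "F \<noteq> F'" "z = F \<inter> F'"
      using z by (auto simp: Z_def)
    then show ?thesis
      using facet_Int_aff_dim[of K F F'] mesh_cell[of K] sub by auto
  qed
  define U where "U = \<Union>\<T>'"
  have U: "compact U" unfolding U_def using fin sub mesh_cell(4) by (intro compact_Union) auto
  have interior_U: "x \<in> interior U" if x: "x \<in> U" "x \<notin> \<Union>Z" for x
  proof -
    obtain K where K: "K \<in> \<T>'" "x \<in> K" using x(1) by (auto simp: U_def)
    then have KT: "K \<in> \<T>" using sub by blast
    have KU: "K \<subseteq> U" using K(1) by (auto simp: U_def)
    show ?thesis
    proof (cases "x \<in> interior K")
      case True
      then show ?thesis using interior_mono KU by blast
    next
      case False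
      then have "x \<in> rel_frontier K"
        using K(2) mesh_cell[OF KT] closure_subset
        by (auto simp: rel_frontier_nonempty_interior frontier_def)
      then obtain F where F: "F facet_of K" "x \<in> F"
        using rel_frontier_of_polyhedron mesh_cell(1)[OF KT] polytope_imp_polyhedron by blast
      obtain K' where K': "K' \<in> \<T>'" "K' \<noteq> K" "F facet_of K'" using nb[OF K(1) F(1)] by blast
      then have KT': "K' \<in> \<T>" and KU': "K' \<subseteq> U" using sub by (auto simp: U_def)
      have only: "F' = F" if "L \<in> \<T>'" "F facet_of L" "F' facet_of L" "x \<in> F'" for L F'
        using that x(2) F(2) unfolding Z_def by blast
      obtain n c where n: "norm n = 1" "F = K \<inter> {x. inner n x = c}" "K \<subseteq> {x. inner n x \<le> c}"
        using facet_supporting_hyperplane[OF mesh_cell(1,2)[OF KT] F(1)] .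
      have Fn: "F \<subseteq> {x. inner n x = c}" "F \<subseteq> {x. inner (- n) x = - c}" using n(2) by auto
      have n0: "n \<noteq> 0" "- n \<noteq> 0" using n(1) by auto
      obtain e where e: "0 < e" "ball x e \<inter> {y. inner n y \<le> c} \<subseteq> K"
        using polytope_half_ball_at_facet[OF mesh_cell(1,2)[OF KT] F(1) n0(1) Fn(1) n(3) F(2)]
          only[OF K(1) F(1)] by blast
      obtain e' where e': "0 < e'" "ball x e' \<inter> {y. inner (- n) y \<le> - c} \<subseteq> K'"
        using polytope_half_ball_at_facet[OF mesh_cell(1,2)[OF KT'] K'(3) n0(2) Fn(2)
            opposite_side(1)[OF KT F(1) Fn(1) n(3,1) KT' K'(3,2)] F(2)]
          only[OF K'(1,3)] by blast
      \<comment> \<open>The half ball of K and the opposite half ball of its neighbour fit together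
        to a full ball.\<close>
      have "ball x (min e e') \<subseteq> K \<union> K'"
      proof
        fix y assume y: "y \<in> ball x (min e e')"
        show "y \<in> K \<union> K'"
        proof (cases "inner n y \<le> c")
          case True
          then show ?thesis using y e(2) by auto
        next
          case False
          then have "y \<in> ball x e' \<inter> {y. inner (- n) y \<le> - c}" using y by auto
          then show ?thesis using e'(2) by blast
        qed
      qed
      then have "ball x (min e e') \<subseteq> U" using KU KU' by blast
      moreover have "x \<in> ball x (min e e')" using e(1) e'(1) by simp
      ultimately show ?thesis by (meson interiorI open_ball)
    qed
  qed
  have negl: "negligible (affine hull z)" if "z \<in> Z" for z
    using negligible_aff_dim_less[of z] dimZ[OF that] by linarith
  have "negligible (\<Union>Z)"
    using finZ negl negligible_subset[OF _ hull_subset] by (intro negligible_Union) blast+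
  moreover have "\<not> negligible (interior K0)"
    using mesh_cell(6) K0 sub by (intro open_not_negligible) auto
  ultimately have "\<not> interior K0 \<subseteq> \<Union>Z" using negligible_subset by blast
  then obtain p where p: "p \<in> interior K0" "p \<notin> \<Union>Z" by blast
  \<comment> \<open>W is the union of the affine hulls through p of the sets in Z. Adding a point
    raises the dimension by at most one, so codimension two leaves W negligible, and the bounded set
    U leaves room for a q outside both.\<close>
  define W where "W = (\<Union>z\<in>Z. affine hull (insert p z))"
  have "negligible (affine hull (insert p z))" if "z \<in> Z" for z
  proof (rule negligible_aff_dim_less)
    have "aff_dim (insert p z) \<le> aff_dim z + 1" by (simp add: aff_dim_insert)
    then show "aff_dim (insert p z) < int DIM(real^'d)" using dimZ[OF that] by linarith
  qed
  then have "negligible W" unfolding W_def using finZ by (intro negligible_Union) auto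
  moreover have "\<not> negligible (- U)"
  proof (rule open_not_negligible)
    show "open (- U)" using compact_imp_closed[OF U] by (rule open_Compl)
    have "U \<noteq> UNIV" using compact_imp_bounded[OF U] not_bounded_UNIV by auto
    then show "- U \<noteq> {}" by auto
  qed
  ultimately have "\<not> - U \<subseteq> W" using negligible_subset by blast
  then obtain q where q: "q \<notin> U" "q \<notin> W" by blast
  have "p \<in> U" using p(1) interior_subset K0 by (auto simp: U_def)
  then have "closed_segment p q \<inter> frontier U \<noteq> {}"
    using q(1) by (intro connected_Int_frontier) auto
  then obtain y where y: "y \<in> closed_segment p q" "y \<in> frontier U" by blast
  have "y \<in> U" "y \<notin> interior U"
    using y(2) compact_imp_closed[OF U] by (auto simp: frontier_def)
  then obtain z where z: "z \<in> Z" "y \<in> z" using interior_U by blast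
  obtain t where t: "y = (1 - t) *\<^sub>R p + t *\<^sub>R q"
    using y(1) by (auto simp: closed_segment_def)
  have "t \<noteq> 0" using t z p(2) by auto
  \<comment> \<open>Solving for q puts it on the line through p and the exit point y. As y lies in
    some z of Z, this line lies in W, against the choice of q.\<close>
  have "q = (1 - 1 / t) *\<^sub>R p + (1 / t) *\<^sub>R y"
    using \<open>t \<noteq> 0\<close> unfolding t by (simp add: algebra_simps diff_divide_distrib)
  moreover have "p \<in> affine hull (insert p z)" "y \<in> affine hull (insert p z)"
    using z(2) by (auto intro: hull_inc)
  ultimately have "q \<in> affine hull (insert p z)"
    using mem_affine[OF affine_affine_hull, of p _ y "1 - 1 / t" "1 / t"] by simp
  then show False using q(2) z(1) by (auto simp: W_def)
qed

end

section \<open>Integrals over cells and facets\<close>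

text \<open>A compact convex set with interior points is the closure of its interior, and its
  frontier is a null set. This reduces the claim to the closure of a bounded open set of positive
  measure, where continuity excludes a positive value even at boundary points.\<close>

lemma integral_zero_imp_zero:
  fixes g :: "'a::euclidean_space \<Rightarrow> real"
  assumes S: "compact S" "convex S" "interior S \<noteq> {}"
    and g: "continuous_on S g" "\<And>x. x \<in> S \<Longrightarrow> 0 \<le> g x"
    and int: "(LINT x:S|lborel. g x) = 0"
    and x: "x \<in> S"
  shows "g x = 0"
proof -
  have cl: "closure (interior S) = S"
    using convex_closure_interior[OF S(2,3)] closure_closed[OF compact_imp_closed[OF S(1)]] by simp
  have si: "set_integrable lborel S g"
    unfolding set_integrable_def using borel_integrable_compact[OF S(1) g(1)] .
  have "g integrable_on S" "(LINT x:S|lborel. g x) = integral S g"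
    using set_borel_integral_eq_integral[OF si] by auto
  then have hi: "(g has_integral 0) (closure (interior S))"
    using int cl integrable_integral[of g S] by simp
  have "frontier S \<in> null_sets lborel"
    using negligible_convex_frontier[OF S(2)]
    by (simp add: null_sets_completion_iff negligible_iff_null_sets)
  then have "emeasure lborel (interior S \<union> frontier S) = emeasure lborel (interior S)"
    by (intro emeasure_Un_null_set) auto
  moreover have "interior S \<union> frontier S = S"
    using compact_imp_closed[OF S(1)] interior_subset[of S] by (auto simp: frontier_def)
  ultimately have reg: "emeasure lborel (closure (interior S)) = emeasure lborel (interior S)"
    using cl by simp
  have "\<not> negligible (interior S)" using S(3) by (intro open_not_negligible) auto
  then have "emeasure lborel (interior S) \<noteq> 0"
    by (auto simp: null_sets_completion_iff negligible_iff_null_sets null_sets_def)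
  then have pos: "0 < emeasure lborel (interior S)" by (simp add: zero_less_iff_neq_zero)
  have "bounded (interior S)" using S(1) compact_imp_bounded bounded_interior by blast
  then have fin: "emeasure lborel (interior S) < \<infinity>" using emeasure_bounded_finite by auto
  show ?thesis
    by (rule has_integral_0_closure_imp_0[where S = "interior S", OF _ _ pos fin reg _ hi])
      (use cl g x interior_subset in auto)
qed

lemma set_integral_nonneg:
  fixes g :: "'a \<Rightarrow> real"
  assumes "\<And>x. x \<in> S \<Longrightarrow> 0 \<le> g x"
  shows "0 \<le> (LINT x:S|M. g x)"
  unfolding set_lebesgue_integral_def
  by (rule Bochner_Integration.integral_nonneg) (auto simp: indicator_def assms)

section \<open>Surface integrals as volume integrals over prisms\<close>

lemma prism_compact_convex:
  fixes n :: "'a::euclidean_space"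
  assumes "compact F" "convex F"
  shows "compact {x + t *\<^sub>R n | x t. x \<in> F \<and> t \<in> {0..1}}"
    and "convex {x + t *\<^sub>R n | x t. x \<in> F \<and> t \<in> {0..1}}"
proof -
  \<comment> \<open>The prism is the Minkowski sum of F and the segment I, so compactness and
    convexity are inherited.\<close>
  define I where "I = (\<lambda>t. t *\<^sub>R n) ` {0..1::real}"
  have eq: "{x + t *\<^sub>R n | x t. x \<in> F \<and> t \<in> {0..1}} = {x + y | x y. x \<in> F \<and> y \<in> I}"
  proof (intro equalityI subsetI)
    fix z assume "z \<in> {x + t *\<^sub>R n | x t. x \<in> F \<and> t \<in> {0..1}}"
    then obtain x t where "z = x + t *\<^sub>R n" "x \<in> F" "t \<in> {0..1}" by blast
    moreover from this have "t *\<^sub>R n \<in> I" unfolding I_def by (intro imageI)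
    ultimately show "z \<in> {x + y | x y. x \<in> F \<and> y \<in> I}" by blast
  next
    fix z assume "z \<in> {x + y | x y. x \<in> F \<and> y \<in> I}"
    then obtain x t where "z = x + t *\<^sub>R n" "x \<in> F" "t \<in> {0..1}" unfolding I_def by blast
    then show "z \<in> {x + t *\<^sub>R n | x t. x \<in> F \<and> t \<in> {0..1}}" by blast
  qed
  have "compact I" unfolding I_def
    by (intro compact_continuous_image continuous_intros compact_Icc)
  then show "compact {x + t *\<^sub>R n | x t. x \<in> F \<and> t \<in> {0..1}}"
    unfolding eq by (intro compact_sums assms(1))
  have "linear (\<lambda>t. t *\<^sub>R n)" by (simp add: linear_scaleR_left)
  then have "convex I" unfolding I_def by (intro convex_linear_image) auto
  then have "convex (\<Union>x\<in>F. \<Union>y\<in>I. {x + y})" by (intro convex_sums assms(2))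
  also have "(\<Union>x\<in>F. \<Union>y\<in>I. {x + y}) = {x + y | x y. x \<in> F \<and> y \<in> I}" by auto
  finally show "convex {x + t *\<^sub>R n | x t. x \<in> F \<and> t \<in> {0..1}}"
    unfolding eq .
qed

text \<open>A flat prism would lie in a hyperplane with normal a. It contains y and y + n, so a is
  orthogonal to n; it contains F, so a is parallel to n by uniqueness of the normal.\<close>

lemma prism_interior:
  fixes n :: "'a::euclidean_space"
  assumes F: "compact F" "convex F" "F \<noteq> {}" "aff_dim F = int DIM('a) - 1"
    and n: "norm n = 1" "F \<subseteq> {x. inner n x = c}"
  shows "interior {x + t *\<^sub>R n | x t. x \<in> F \<and> t \<in> {0..1}} \<noteq> {}" (is "interior ?P \<noteq> {}")
proof
  assume "interior ?P = {}"
  then obtain a b where a: "a \<noteq> 0" "?P \<subseteq> {x. inner a x = b}"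
    using empty_interior_subset_hyperplane[OF prism_compact_convex(2)[OF F(1,2)]] by blast
  have mem: "x \<in> ?P" "x + n \<in> ?P" if "x \<in> F" for x
  proof -
    have "x + t *\<^sub>R n \<in> ?P" if "t \<in> {0..1}" for t using that \<open>x \<in> F\<close> by blast
    from this[of 0] this[of 1] show "x \<in> ?P" "x + n \<in> ?P" by simp_all
  qed
  obtain y where "y \<in> F" using F(3) by blast
  then have "inner a y = b" "inner a (y + n) = b" using mem a(2) by blast+
  then have an: "inner a n = 0" by (simp add: inner_add_right)
  define m where "m = a /\<^sub>R norm a"
  have "norm m = 1" using a(1) by (simp add: m_def)
  moreover have "F \<subseteq> {x. inner m x = b / norm a}"
    using mem(1) a by (auto simp: m_def field_simps)
  ultimately have "m = n \<or> m = - n"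
    using unit_normal_unique[OF F(4,3) n(1) _ n(2)] by blast
  moreover have "inner m n = 0" using an by (simp add: m_def)
  moreover have "inner n n = 1" using n(1) by (simp add: dot_square_norm)
  ultimately show False by auto
qed

text \<open>The assumption \<open>ex\<close> supplies a witness for the choice in
  \<open>surface_measure\<close>, so the chosen pair really describes a hyperplane containing F. The
  integral against the image measure then pulls back to the prism.\<close>

lemma surface_integral_prism:
  fixes F :: "(real^'d) set"
  assumes F: "compact F" "convex F"
    and ex: "norm m = 1" "F \<subseteq> {x. inner m x = e}"
  obtains n c where "norm n = 1" "F \<subseteq> {x. inner n x = c}"
    "\<And>g :: real^'d \<Rightarrow> real. continuous_on F g \<Longrightarrow> (LINT x:F|surface_measure F. g x) =
      (LINT y:{x + t *\<^sub>R n | x t. x \<in> F \<and> t \<in> {0..1}}|lborel. g (y - (inner n y - c) *\<^sub>R n))"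
proof -
  define P where "P = (\<lambda>(n, c). norm n = 1 \<and> (\<forall>x\<in>F. inner n x = c))"
  have "P (m, e)" using ex by (auto simp: P_def)
  then have "P (Eps P)" by (rule someI)
  moreover obtain n c where nc: "Eps P = (n, c)" by fastforce
  ultimately have n: "norm n = 1" "F \<subseteq> {x. inner n x = c}" by (auto simp: P_def)
  define R where "R = {x + t *\<^sub>R n | x t. x \<in> F \<and> t \<in> {0..1}}"
  define \<pi> where "\<pi> = (\<lambda>y. y - (inner n y - c) *\<^sub>R n)"
  have sm: "surface_measure F = distr (restrict_space lborel R) borel \<pi>"
    using nc unfolding surface_measure_def P_def[symmetric] R_def \<pi>_def by simp
  have R: "R \<in> sets borel"
    unfolding R_def by (intro borel_closed compact_imp_closed prism_compact_convex(1) F)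
  have nn: "inner n n = 1" using n(1) by (simp add: dot_square_norm)
  have piF: "\<pi> y \<in> F" if y: "y \<in> R" for y
  proof -
    obtain x t where "x \<in> F" "y = x + t *\<^sub>R n" using y by (auto simp: R_def)
    then have "\<pi> y = x" using n(2) nn by (auto simp: \<pi>_def inner_add_right)
    then show ?thesis using \<open>x \<in> F\<close> by simp
  qed
  have meas: "\<pi> \<in> measurable (restrict_space lborel R) borel"
    unfolding \<pi>_def by (intro measurable_restrict_space1) simp
  show thesis
  proof
    fix g :: "real^'d \<Rightarrow> real" assume g: "continuous_on F g"
    have bm: "(\<lambda>x. indicator F x *\<^sub>R g x) \<in> borel_measurable borel"
      using g borel_closed[OF compact_imp_closed[OF F(1)]]
      by (rule borel_measurable_continuous_on_indicator[rotated])
    have "(LINT x:F|surface_measure F. g x)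
        = (LINT y|restrict_space lborel R. indicator F (\<pi> y) *\<^sub>R g (\<pi> y))"
      unfolding set_lebesgue_integral_def sm by (rule integral_distr[OF meas bm])
    also have "\<dots> = (LINT y:R|lborel. indicator F (\<pi> y) *\<^sub>R g (\<pi> y))"
      unfolding set_lebesgue_integral_def using R by (intro integral_restrict_space) simp
    \<comment> \<open>The projection maps the prism back into F, so the indicator equals 1
      throughout.\<close>
    also have "\<dots> = (LINT y:R|lborel. g (\<pi> y))"
      using R piF by (intro set_lebesgue_integral_cong) auto
    finally show "(LINT x:F|surface_measure F. g x) =
      (LINT y:{x + t *\<^sub>R n | x t. x \<in> F \<and> t \<in> {0..1}}|lborel. g (y - (inner n y - c) *\<^sub>R n))"
      unfolding R_def \<pi>_def .
  qed (use n in auto)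
qed

text \<open>Extend g to the prism so that it is constant along the normal and apply the volume
  version there. The projection fixes F, so the values of g on F are recovered.\<close>

lemma surface_integral_zero_imp_zero:
  fixes F :: "(real^'d) set" and g :: "real^'d \<Rightarrow> real"
  assumes F: "compact F" "convex F" "F \<noteq> {}" "aff_dim F = int DIM(real^'d) - 1"
    and ex: "norm m = 1" "F \<subseteq> {x. inner m x = e}"
    and g: "continuous_on F g" "\<And>x. x \<in> F \<Longrightarrow> 0 \<le> g x"
    and int: "(LINT x:F|surface_measure F. g x) = 0"
    and x: "x \<in> F"
  shows "g x = 0"
proof -
  obtain n c where n: "norm n = 1" "F \<subseteq> {x. inner n x = c}"
    and eq: "\<And>g :: real^'d \<Rightarrow> real. continuous_on F g \<Longrightarrow> (LINT x:F|surface_measure F. g x) =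
      (LINT y:{x + t *\<^sub>R n | x t. x \<in> F \<and> t \<in> {0..1}}|lborel. g (y - (inner n y - c) *\<^sub>R n))"
    using surface_integral_prism[OF F(1,2) ex] by blast
  define R where "R = {x + t *\<^sub>R n | x t. x \<in> F \<and> t \<in> {0..1}}"
  define \<pi> where "\<pi> = (\<lambda>y. y - (inner n y - c) *\<^sub>R n)"
  have nn: "inner n n = 1" using n(1) by (simp add: dot_square_norm)
  have piF: "\<pi> ` R \<subseteq> F"
    using n(2) nn by (auto simp: R_def \<pi>_def inner_add_right)
  have "g (\<pi> x) = 0"
  proof (rule integral_zero_imp_zero[where S = R and g = "\<lambda>y. g (\<pi> y)"])
    show "compact R" "convex R" unfolding R_def using prism_compact_convex[OF F(1,2)] by auto
    show "interior R \<noteq> {}" unfolding R_def using prism_interior[OF F n] .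
    have "continuous_on R \<pi>" unfolding \<pi>_def by (intro continuous_intros)
    then show "continuous_on R (\<lambda>y. g (\<pi> y))"
      using continuous_on_compose2[OF g(1) _ piF] by blast
    show "(LINT y:R|lborel. g (\<pi> y)) = 0"
      using eq[OF g(1)] int unfolding R_def \<pi>_def by simp
    have "x + t *\<^sub>R n \<in> R" if "t \<in> {0..1}" for t using x that unfolding R_def by blast
    from this[of 0] show "x \<in> R" by simp
    show "0 \<le> g (\<pi> y)" if "y \<in> R" for y using g(2) piF that by blast
  qed
  moreover have "\<pi> x = x" using x n(2) by (auto simp: \<pi>_def)
  ultimately show ?thesis by simp
qed

section \<open>Differentiating polynomials on closed cells\<close>

lemma real_polynomial_function_C1:
  fixes p :: "'a::euclidean_space \<Rightarrow> real"
  assumes "real_polynomial_function p"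
  shows "\<exists>g. continuous_on UNIV g \<and> (\<forall>x. (p has_derivative (\<lambda>h. inner (g x) h)) (at x))"
  using assms
proof (induction p rule: real_polynomial_function.induct)
  case (linear f)
  \<comment> \<open>The vector representing the functional f in the inner product is its constant
    gradient.\<close>
  define a where "a = adjoint f 1"
  have "inner h a = inner (f h) 1" for h
    unfolding a_def by (rule adjoint_works[OF bounded_linear.linear[OF linear]])
  then have "(\<lambda>h. inner a h) = f"
    by (intro ext) (simp add: inner_commute)
  then have "(f has_derivative (\<lambda>h. inner a h)) (at x)" for x
    using bounded_linear_imp_has_derivative[OF linear] by simp
  then show ?case by (intro exI[of _ "\<lambda>_. a"]) simp
next
  case (const c)
  then show ?case by (intro exI[of _ "\<lambda>_. 0"]) auto
next
  case (add f g)
  then obtain f' g' where f': "continuous_on UNIV f'" "\<And>x. (f has_derivative (\<lambda>h. inner (f' x) h)) (at x)"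
    and g': "continuous_on UNIV g'" "\<And>x. (g has_derivative (\<lambda>h. inner (g' x) h)) (at x)" by blast
  have "((\<lambda>x. f x + g x) has_derivative (\<lambda>h. inner (f' x + g' x) h)) (at x)" for x
    using has_derivative_add[OF f'(2) g'(2)] by (simp add: inner_add_left)
  then show ?case
    using f'(1) g'(1) by (intro exI[of _ "\<lambda>x. f' x + g' x"]) (auto intro: continuous_intros)
next
  case (mult f g)
  then obtain f' g' where f': "continuous_on UNIV f'" "\<And>x. (f has_derivative (\<lambda>h. inner (f' x) h)) (at x)"
    and g': "continuous_on UNIV g'" "\<And>x. (g has_derivative (\<lambda>h. inner (g' x) h)) (at x)" by blast
  have "((\<lambda>x. f x * g x) has_derivative (\<lambda>h. inner (f x *\<^sub>R g' x + g x *\<^sub>R f' x) h)) (at x)" for x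
    using has_derivative_mult[OF f'(2)[of x] g'(2)[of x]] by (simp add: inner_add_left mult.commute)
  moreover have "continuous_on UNIV f" "continuous_on UNIV g"
    using mult.hyps by (simp_all add: real_polynomial_function_eq continuous_on_polymonial_function)
  ultimately show ?case
    using f'(1) g'(1) by (intro exI[of _ "\<lambda>x. f x *\<^sub>R g' x + g x *\<^sub>R f' x"])
      (auto intro!: continuous_intros)
qed

text \<open>A member of \<open>polys\<close> is cut off to 0 outside D and may jump there. Removing
  the cut-off gives a global polynomial, from which continuity and derivatives on D are
  taken.\<close>

lemma polys_extension:
  assumes "f \<in> polys k D"
  obtains p where "real_polynomial_function p" "\<And>x. x \<in> D \<Longrightarrow> f x = p x"
proof -
  obtain c where c: "\<And>x. f x = (if x \<in> D then
      \<Sum>\<alpha> | sum \<alpha> UNIV \<le> k. c \<alpha> * (\<Prod>i\<in>UNIV. (x $ i) ^ \<alpha> i) else 0)"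
    using assms by (auto simp: polys_def)
  have pow: "real_polynomial_function (\<lambda>x::real^'a. (x $ i) ^ m)" for i m
    by (induction m) (simp_all add: real_polynomial_function.intros bounded_linear_vec_nth)
  show thesis
  proof
    show "real_polynomial_function
        (\<lambda>x. \<Sum>\<alpha> | sum \<alpha> UNIV \<le> k. c \<alpha> * (\<Prod>i\<in>UNIV. (x $ i) ^ \<alpha> i))"
    \<comment> \<open>The infinite case needs no refutation: a sum over an infinite set is 0 by
      convention, which is again a polynomial.\<close>
    proof (cases "finite {\<alpha> :: 'a \<Rightarrow> nat. sum \<alpha> UNIV \<le> k}")
      case True
      then show ?thesis
        by (intro real_polynomial_function_sum real_polynomial_function_prod
            real_polynomial_function.intros(4) real_polynomial_function.intros(2) pow) auto
    qed auto
  qed (simp add: c)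
qed

lemma polys_outside: "f \<in> polys k D \<Longrightarrow> x \<notin> D \<Longrightarrow> f x = 0"
  by (auto simp: polys_def)

lemma polys_continuous:
  assumes "f \<in> polys k D"
  shows "continuous_on D f"
proof -
  obtain p where p: "real_polynomial_function p" "\<And>x. x \<in> D \<Longrightarrow> f x = p x"
    using polys_extension[OF assms] by blast
  have "continuous_on D p"
    using p(1) by (simp add: real_polynomial_function_eq continuous_on_polymonial_function)
  then show ?thesis by (rule continuous_on_eq) (simp add: p(2))
qed

text \<open>Needed because \<open>grad\<close> differentiates within the closed cell, also at its
  boundary points. The difference D of two derivatives is a derivative of 0, so along each segment
  from x to y in K it vanishes on y - x; since K contains a ball, these directions span the
  space.\<close>

lemma has_derivative_unique_within_convex:
  fixes f :: "'a::euclidean_space \<Rightarrow> 'b::real_normed_vector"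
  assumes f: "(f has_derivative f') (at x within K)" "(f has_derivative f'') (at x within K)"
    and K: "convex K" "interior K \<noteq> {}" "x \<in> K"
  shows "f' = f''"
proof -
  define D where "D = (\<lambda>h. f' h - f'' h)"
  have D: "((\<lambda>_. 0) has_derivative D) (at x within K)"
    using has_derivative_diff[OF f] by (simp add: D_def)
  have lin: "linear D" by (rule has_derivative_linear[OF D])
  have dir: "D (y - x) = 0" if y: "y \<in> K" for y
  proof -
    define \<gamma> where "\<gamma> = (\<lambda>t. x + t *\<^sub>R (y - x))"
    have seg: "\<gamma> ` {0..1} \<subseteq> K"
    proof (clarsimp simp: \<gamma>_def)
      fix t :: real assume "0 \<le> t" "t \<le> 1"
      then have "(1 - t) *\<^sub>R x + t *\<^sub>R y \<in> K" using K(1,3) y by (intro convexD) auto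
      then show "x + t *\<^sub>R (y - x) \<in> K" by (simp add: algebra_simps)
    qed
    have "(\<gamma> has_derivative (\<lambda>t. t *\<^sub>R (y - x))) (at 0 within {0..1})"
      unfolding \<gamma>_def by (auto intro!: derivative_eq_intros)
    moreover have "((\<lambda>_. 0) has_derivative D) (at (\<gamma> 0) within \<gamma> ` {0..1})"
      using has_derivative_subset[OF D seg] by (simp add: \<gamma>_def)
    ultimately have "((\<lambda>_. 0) \<circ> \<gamma> has_derivative D \<circ> (\<lambda>t. t *\<^sub>R (y - x))) (at 0 within {0..1})"
      by (rule diff_chain_within)
    then have "((\<lambda>_. 0) has_vector_derivative D (y - x)) (at 0 within {0..1::real})"
      by (simp add: has_vector_derivative_def o_def linear_scale[OF lin])
    moreover have "((\<lambda>_. 0) has_vector_derivative (0::'b)) (at 0 within {0..1::real})"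
      by simp
    ultimately show ?thesis
      using vector_derivative_unique_within_closed_interval[of 0 1 0 "\<lambda>_. 0" "D (y - x)" 0]
      by (simp add: cbox_interval)
  qed
  obtain z e where z: "0 < e" "ball z e \<subseteq> K"
    using K(2) by (auto simp: mem_interior)
  have "D h = 0" for h
  proof (cases "h = 0")
    case True
    then show ?thesis using linear_0[OF lin] by simp
  next
    case False
    \<comment> \<open>The scaling keeps z + s h in the ball around z, so s h is a difference of two
      directions annihilated by D.\<close>
    define s where "s = e / (2 * norm h)"
    have s: "s > 0" using z(1) False by (simp add: s_def)
    have "norm (s *\<^sub>R h) = e / 2" using z(1) False by (simp add: s_def)
    then have "z \<in> K" "z + s *\<^sub>R h \<in> K" using z by (auto simp: dist_norm subset_iff)
    then have "D (z - x) = 0" "D (z + s *\<^sub>R h - x) = 0" using dir by blast+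
    then have "D (z + s *\<^sub>R h - x - (z - x)) = 0" by (simp only: linear_diff[OF lin]) simp
    moreover have "z + s *\<^sub>R h - x - (z - x) = s *\<^sub>R h" by simp
    ultimately have "s *\<^sub>R D h = 0" by (simp only: linear_scale[OF lin])
    then show ?thesis using s by simp
  qed
  then show ?thesis by (auto simp: D_def)
qed

lemma V_space_grad:
  assumes K: "convex K" "interior K \<noteq> {}" "K \<in> \<T>" and v: "v \<in> V_space \<T> k"
  shows "x \<in> K \<Longrightarrow> (v K has_derivative (\<lambda>h. grad v K x *v h)) (at x within K)"
    and "continuous_on K (grad v K)"
    and "continuous_on K (v K)"
proof -
  have "\<exists>p g. (\<forall>x\<in>K. v K x $ i = p x) \<and> continuous_on UNIV g \<and>
      (\<forall>x. (p has_derivative (\<lambda>h. inner (g x) h)) (at x))" for i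
  proof -
    have "(\<lambda>x. v K x $ i) \<in> polys k K" using v K(3) by (auto simp: V_space_def)
    then obtain p where "real_polynomial_function p" "\<And>x. x \<in> K \<Longrightarrow> v K x $ i = p x"
      by (rule polys_extension) blast
    then show ?thesis using real_polynomial_function_C1 by blast
  qed
  then obtain p g where p: "\<And>i x. x \<in> K \<Longrightarrow> v K x $ i = p i x"
    and g: "\<And>i. continuous_on UNIV (g i)" "\<And>i x. (p i has_derivative (\<lambda>h. inner (g i x) h)) (at x)"
    by metis
  define G where "G = (\<lambda>x. \<chi> i. g i x)"
  have der: "(v K has_derivative (\<lambda>h. G x *v h)) (at x within K)" if x: "x \<in> K" for x
    unfolding has_derivative_componentwise_within[of "v K"]
  proof
    fix b :: "real^'a" assume "b \<in> Basis"
    then obtain i where b: "b = axis i 1" by (auto simp: Basis_vec_def)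
    have "(p i has_derivative (\<lambda>h. inner (g i x) h)) (at x within K)"
      by (rule has_derivative_at_withinI[OF g(2)])
    then have "((\<lambda>x. v K x $ i) has_derivative (\<lambda>h. inner (g i x) h)) (at x within K)"
      by (rule has_derivative_transform[OF x, rotated]) (simp add: p)
    then show "((\<lambda>x. inner (v K x) b) has_derivative (\<lambda>h. inner (G x *v h) b)) (at x within K)"
      by (simp add: b inner_axis G_def matrix_vector_mul_component)
  qed
  have eq: "grad v K x = G x" if x: "x \<in> K" for x
  proof -
    have "v K differentiable (at x within K)" by (rule differentiableI[OF der[OF x]])
    then have "(v K has_derivative (\<lambda>h. grad v K x *v h)) (at x within K)"
      unfolding grad_def jacobian_works .
    \<comment> \<open>The Jacobian is built from some chosen derivative; uniqueness identifies it
      with the continuous matrix field G.\<close>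
    then have "(\<lambda>h. grad v K x *v h) = (\<lambda>h. G x *v h)"
      by (rule has_derivative_unique_within_convex[OF _ der[OF x] K(1,2) x])
    then show ?thesis by (simp add: matrix_eq fun_eq_iff)
  qed
  show "x \<in> K \<Longrightarrow> (v K has_derivative (\<lambda>h. grad v K x *v h)) (at x within K)" for x
    using der eq by simp
  have "continuous_on K G"
    unfolding G_def by (intro continuous_on_vec_lambda continuous_on_subset[OF g(1)]) auto
  then show "continuous_on K (grad v K)" by (rule continuous_on_eq) (simp add: eq)
  show "continuous_on K (v K)" by (rule has_derivative_continuous_on) (rule der)
qed

section \<open>Definiteness of the discrete norms\<close>

lemma outer_component: "vec_nth (vec_nth (u \<otimes>\<^bsub>v\<^esub> w) i) j = vec_nth u i * vec_nth w j"
  by (simp add: outer_def)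

lemma outer_eq_0:
  assumes "u \<otimes>\<^bsub>v\<^esub> w = 0" "w \<noteq> 0"
  shows "u = 0"
proof -
  obtain j where "vec_nth w j \<noteq> 0" using assms(2) by (auto simp: Finite_Cartesian_Product.vec_eq_iff)
  moreover have "vec_nth u i * vec_nth w j = 0" for i
    using assms(1) outer_component[of u w i j] by simp
  ultimately show ?thesis by (simp add: Finite_Cartesian_Product.vec_eq_iff)
qed

lemma outer_add_uminus: "u \<otimes>\<^bsub>v\<^esub> n + w \<otimes>\<^bsub>v\<^esub> (- n) = (u - w) \<otimes>\<^bsub>v\<^esub> n"
  by (simp only: Finite_Cartesian_Product.vec_eq_iff outer_component vector_add_component vector_minus_component
      vector_uminus_component) (simp add: algebra_simps)

lemma continuous_on_outer:
  "continuous_on S u \<Longrightarrow> continuous_on S (\<lambda>x. u x \<otimes>\<^bsub>v\<^esub> n)"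
  unfolding outer_def by (intro continuous_intros continuous_on_vec_lambda)

lemma l2_norm_eq_0:
  assumes mesh: "simplicial_mesh \<Omega> \<T>"
    and q: "q \<in> Q_space \<T> k" and zero: "l2_norm \<T> q = 0"
  shows "q = (\<lambda>_ _. 0)"
proof -
  have "(\<Sum>K\<in>\<T>. LINT x:K|lborel. (q K x)\<^sup>2) = 0" using zero by (simp add: l2_norm_def)
  then have int: "(LINT x:K|lborel. (q K x)\<^sup>2) = 0" if "K \<in> \<T>" for K
    using sum_nonneg_0[OF finite_mesh[OF mesh], of "\<lambda>K. LINT x:K|lborel. (q K x)\<^sup>2" K] that
    by (simp add: set_integral_nonneg)
  have "q K x = 0" for K x
  proof (cases "K \<in> \<T> \<and> x \<in> K")
    case True
    then have "continuous_on K (q K)" using q polys_continuous by (auto simp: Q_space_def)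
    then have "(q K x)\<^sup>2 = 0"
      using integral_zero_imp_zero[OF mesh_cell(4,3,6)[OF mesh], of K "\<lambda>x. (q K x)\<^sup>2" x] True int
      by (auto intro!: continuous_intros)
    then show ?thesis by simp
  next
    case False
    then show ?thesis using q polys_outside by (fastforce simp: Q_space_def)
  qed
  then show ?thesis by blast
qed

section \<open>The two sides of a facet and the norms over facets\<close>

context
  fixes \<Omega> :: "(real^'d) set" and \<T> :: "(real^'d) set set" and kp :: "(real^'d) set \<Rightarrow> (real^'d) set"
  assumes mesh: "simplicial_mesh \<Omega> \<T>"
    and labelling: "facet_labelling \<T> kp"
begin

lemma kp_cell:
  assumes "F \<in> facets \<T>"
  shows "kp F \<in> \<T>" "F facet_of kp F"
  using assms labelling by (auto simp: facet_labelling_def)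

text \<open>The definite description in \<open>minus_side\<close> is meaningful: an interior facet
  has a cell other than \<open>kp F\<close>, and \<open>at_most_two_cells\<close> makes it
  unique.\<close>

lemma minus_side_cell:
  assumes "F \<in> interior_facets \<T>"
  shows "minus_side \<T> kp F \<in> \<T>" "F facet_of minus_side \<T> kp F" "minus_side \<T> kp F \<noteq> kp F"
proof -
  obtain K K' where K: "K \<in> \<T>" "K' \<in> \<T>" "K \<noteq> K'" "F facet_of K" "F facet_of K'"
    using assms by (auto simp: interior_facets_def)
  have "F \<in> facets \<T>" using K by (auto simp: facets_def)
  note kp = kp_cell[OF this]
  obtain L where L: "L \<in> \<T>" "F facet_of L" "L \<noteq> kp F" using K by metis
  have "minus_side \<T> kp F = L"
    unfolding minus_side_def
    by (rule the_equality) (use L at_most_two_cells[OF mesh kp] in blast)+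
  then show "minus_side \<T> kp F \<in> \<T>" "F facet_of minus_side \<T> kp F" "minus_side \<T> kp F \<noteq> kp F"
    using L by auto
qed

lemma cell_of_facet_cases:
  assumes "K \<in> \<T>" "F facet_of K"
  obtains "F \<in> interior_facets \<T>" "K = kp F" | "F \<in> interior_facets \<T>" "K = minus_side \<T> kp F"
    | "F \<notin> interior_facets \<T>" "K = kp F"
proof -
  have F: "F \<in> facets \<T>" using assms by (auto simp: facets_def)
  show thesis
  proof (cases "F \<in> interior_facets \<T>")
    case True
    then show thesis
      using at_most_two_cells[OF mesh kp_cell[OF F], of K "minus_side \<T> kp F"]
        minus_side_cell[OF True] assms that by blast
  next
    case False
    then have "K = kp F" using kp_cell[OF F] assms by (auto simp: interior_facets_def)
    then show thesis using False that by blast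
  qed
qed

lemma normals:
  assumes F: "F \<in> facets \<T>"
  shows "norm (normal_plus kp F) = 1"
    and "\<exists>c. F \<subseteq> {x. inner (normal_plus kp F) x = c}"
    and "F \<in> interior_facets \<T> \<Longrightarrow> normal_minus \<T> kp F = - normal_plus kp F"
proof -
  note kp = kp_cell[OF F]
  obtain n c where n: "norm n = 1" "F = kp F \<inter> {x. inner n x = c}" "kp F \<subseteq> {x. inner n x \<le> c}"
    using facet_supporting_hyperplane[OF mesh_cell(1,2)[OF mesh kp(1)] kp(2)] .
  have Fn: "F \<subseteq> {x. inner n x = c}" using n(2) by blast
  have np: "normal_plus kp F = n"
    unfolding normal_plus_def using outward_normal_eq[OF mesh kp n(1) Fn n(3)] .
  show "norm (normal_plus kp F) = 1" "\<exists>c. F \<subseteq> {x. inner (normal_plus kp F) x = c}"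
    using np n(1) Fn by auto
  show "normal_minus \<T> kp F = - normal_plus kp F" if "F \<in> interior_facets \<T>"
    unfolding np normal_minus_def
    using opposite_side(2)[OF mesh kp Fn n(3,1)] minus_side_cell[OF that] by blast
qed

lemma facet_geometry:
  assumes "F \<in> facets \<T>"
  shows "compact F" "convex F" "F \<noteq> {}" "aff_dim F = int DIM(real^'d) - 1"
  using mesh_facet[OF mesh kp_cell[OF assms]] by auto

text \<open>Here d \<ge> 2 enters: facets then have positive dimension and contain two points. For d
  = 1 a facet is a single point of diameter 0, and the weight \<open>inverse (diameter F)\<close>
  would be 0 and hide the jumps.\<close>

lemma diameter_facet_pos:
  assumes d: "2 \<le> CARD('d)" and F: "F \<in> facets \<T>"
  shows "0 < diameter F"
proof -
  have "aff_dim F \<ge> 1" using facet_geometry(4)[OF F] d by simp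
  then have "\<not> (\<exists>a. F = {a})" by auto
  then obtain x y where xy: "x \<in> F" "y \<in> F" "x \<noteq> y" using facet_geometry(3)[OF F] by blast
  have "dist x y \<le> diameter F"
    using xy facet_geometry(1)[OF F] compact_imp_bounded diameter_bounded_bound by blast
  moreover have "0 < dist x y" using xy by simp
  ultimately show ?thesis by linarith
qed

lemma facet_integral_zero_imp_zero:
  fixes g :: "real^'d \<Rightarrow> real"
  assumes F: "F \<in> facets \<T>"
    and g: "continuous_on F g" "\<And>x. x \<in> F \<Longrightarrow> 0 \<le> g x"
    and int: "(LINT x:F|surface_measure F. g x) = 0" and x: "x \<in> F"
  shows "g x = 0"
proof -
  obtain c where c: "F \<subseteq> {x. inner (normal_plus kp F) x = c}" using normals(2)[OF F] by blast
  show ?thesis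
    using surface_integral_zero_imp_zero[OF facet_geometry[OF F] normals(1)[OF F] c g int x] .
qed

lemma jump_tensor_interior:
  assumes "F \<in> facets \<T>" "F \<in> interior_facets \<T>"
  shows "jump_tensor \<T> kp v F x =
    (v (kp F) x - v (minus_side \<T> kp F) x) \<otimes>\<^bsub>v\<^esub> normal_plus kp F"
  using assms by (simp add: jump_tensor_def normals(3) outer_add_uminus)

lemma jump_tensor_boundary:
  assumes "F \<notin> interior_facets \<T>"
  shows "jump_tensor \<T> kp v F x = v (kp F) x \<otimes>\<^bsub>v\<^esub> normal_plus kp F"
  using assms by (simp add: jump_tensor_def)

lemma jump_tensor_continuous:
  assumes v: "v \<in> V_space \<T> k" and F: "F \<in> facets \<T>"
  shows "continuous_on F (jump_tensor \<T> kp v F)"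
proof -
  have cont: "continuous_on F (v K)" if "K \<in> \<T>" "F facet_of K" for K
    using V_space_grad(3)[OF mesh_cell(3,6)[OF mesh that(1)] that(1) v]
      mesh_facet(5)[OF mesh that] continuous_on_subset by blast
  show ?thesis
  proof (cases "F \<in> interior_facets \<T>")
    case True
    have "continuous_on F (\<lambda>x. (v (kp F) x - v (minus_side \<T> kp F) x) \<otimes>\<^bsub>v\<^esub> normal_plus kp F)"
      by (intro continuous_on_outer continuous_on_diff cont kp_cell[OF F] minus_side_cell[OF True])
    then show ?thesis using jump_tensor_interior[OF F True] by (simp add: fun_eq_iff[symmetric])
  next
    case False
    have "continuous_on F (\<lambda>x. v (kp F) x \<otimes>\<^bsub>v\<^esub> normal_plus kp F)"
      by (intro continuous_on_outer cont kp_cell[OF F])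
    then show ?thesis using jump_tensor_boundary[OF False] by (simp add: fun_eq_iff[symmetric])
  qed
qed

lemma dg_norm_nonneg: "0 \<le> dg_norm \<T> kp v"
proof -
  have "0 \<le> diameter F" if "F \<in> facets \<T>" for F
    using facet_geometry(1)[OF that] compact_imp_bounded diameter_ge_0 by blast
  then show ?thesis
    unfolding dg_norm_def
    by (intro real_sqrt_ge_zero add_nonneg_nonneg sum_nonneg set_integral_nonneg) auto
qed

lemma dg_norm_eq_0:
  assumes d: "2 \<le> CARD('d)" and v: "v \<in> V_space \<T> k" and zero: "dg_norm \<T> kp v = 0"
  shows "v = (\<lambda>_ _. 0)"
proof -
  let ?a = "\<lambda>K. LINT x:K|lborel. (norm (grad v K x))\<^sup>2"
  let ?b = "\<lambda>F. LINT x:F|surface_measure F. inverse (diameter F) * (norm (jump_tensor \<T> kp v F x))\<^sup>2"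
  have pos: "0 < diameter F" if "F \<in> facets \<T>" for F using diameter_facet_pos d that by blast
  have a: "0 \<le> ?a K" for K by (intro set_integral_nonneg) auto
  have b: "0 \<le> ?b F" if "F \<in> facets \<T>" for F
    using pos[OF that] by (intro set_integral_nonneg) auto
  have "sum ?a \<T> + sum ?b (facets \<T>) = 0" using zero by (simp add: dg_norm_def)
  moreover have "0 \<le> sum ?a \<T>" "0 \<le> sum ?b (facets \<T>)" using a b by (auto intro: sum_nonneg)
  ultimately have "sum ?a \<T> = 0" "sum ?b (facets \<T>) = 0" by linarith+
  then have a0: "?a K = 0" if "K \<in> \<T>" for K
    using sum_nonneg_0[OF finite_mesh[OF mesh], of ?a K] a that by blast
  have b0: "?b F = 0" if "F \<in> facets \<T>" for F
    using sum_nonneg_0[OF finite_facets[OF mesh], of ?b F] b that \<open>sum ?b (facets \<T>) = 0\<close> by blast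
  have "\<exists>c. \<forall>x\<in>K. v K x = c" if K: "K \<in> \<T>" for K
  proof -
    note cell = mesh_cell[OF mesh K]
    note V = V_space_grad[OF cell(3,6) K v]
    have "continuous_on K (\<lambda>x. (norm (grad v K x))\<^sup>2)" using V(2) by (intro continuous_intros)
    then have "(norm (grad v K x))\<^sup>2 = 0" if "x \<in> K" for x
      using integral_zero_imp_zero[OF cell(4,3,6) _ _ a0[OF K] that] by simp
    then have "(v K has_derivative (\<lambda>h. 0)) (at x within K)" if "x \<in> K" for x
      using V(1)[OF that] that by simp
    then show ?thesis using has_derivative_zero_constant[OF cell(3)] by metis
  qed
  then obtain w where w: "\<And>K x. K \<in> \<T> \<Longrightarrow> x \<in> K \<Longrightarrow> v K x = w K" by metis
  have jump0: "jump_tensor \<T> kp v F x = 0" if F: "F \<in> facets \<T>" and x: "x \<in> F" for F x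
  proof -
    have "inverse (diameter F) * (norm (jump_tensor \<T> kp v F x))\<^sup>2 = 0"
      by (rule facet_integral_zero_imp_zero[OF F _ _ b0[OF F] x])
        (use jump_tensor_continuous[OF v F] pos[OF F] in \<open>auto intro!: continuous_intros\<close>)
    then show ?thesis using pos[OF F] by simp
  qed
  \<comment> \<open>By now v is constant on each cell and has vanishing jumps. The cells carrying a
    nonzero constant are shown to form a subcomplex in which every facet is shared.\<close>
  have "{K \<in> \<T>. w K \<noteq> 0} = {}"
  proof (rule no_closed_subcomplex[OF mesh])
    fix K F assume "K \<in> {K \<in> \<T>. w K \<noteq> 0}" and KF: "F facet_of K"
    then have K: "K \<in> \<T>" "w K \<noteq> 0" by auto
    have F: "F \<in> facets \<T>" using K KF by (auto simp: facets_def)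
    have n: "normal_plus kp F \<noteq> 0" using normals(1)[OF F] by auto
    \<comment> \<open>One point of F suffices, as the traces from both sides are constants.\<close>
    obtain x where x: "x \<in> F" using facet_geometry(3)[OF F] by blast
    then have mem: "x \<in> L" if "F facet_of L" for L using that facet_of_imp_subset by blast
    have eq: "w (kp F) = w (minus_side \<T> kp F)" if I: "F \<in> interior_facets \<T>"
      using jump0[OF F x] jump_tensor_interior[OF F I, of v x] outer_eq_0[OF _ n]
        w kp_cell[OF F] minus_side_cell[OF I] mem by (metis right_minus_eq)
    show "\<exists>K'\<in>{K \<in> \<T>. w K \<noteq> 0}. K' \<noteq> K \<and> F facet_of K'"
      using K(1) KF
    proof (cases rule: cell_of_facet_cases)
      case 1
      then show ?thesis using eq K minus_side_cell[OF 1(1)] by auto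
    next
      case 2
      then show ?thesis
        using eq K minus_side_cell(3)[OF 2(1)] kp_cell[OF F] by (intro bexI[of _ "kp F"]) auto
    next
      \<comment> \<open>On a boundary facet the jump is the trace itself, so it forces the constant
        on K to be 0, a contradiction.\<close>
      case 3
      then have "v K x = 0"
        using jump0[OF F x] jump_tensor_boundary[OF 3(1), of v x] outer_eq_0[OF _ n] by simp
      then show ?thesis using w[OF K(1) mem[OF KF]] K(2) by simp
    qed
  qed auto
  then have w0: "w K = 0" if "K \<in> \<T>" for K using that by blast
  have "v K x = 0" for K x
  proof (cases "K \<in> \<T>")
    case True
    \<comment> \<open>Equality of broken functions also concerns points outside the cell, where the
      pieces are 0 by convention.\<close>
    then have "v K x $ i = 0" if "x \<notin> K" for i
      using v polys_outside[OF _ that] by (auto simp: V_space_def)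
    then show ?thesis using w[OF True] w0[OF True] by (cases "x \<in> K") (auto simp: Finite_Cartesian_Product.vec_eq_iff)
  next
    case False
    then show ?thesis using v by (simp add: V_space_def)
  qed
  then show ?thesis by blast
qed

lemma lambda_norm_eq_0:
  assumes d: "2 \<le> CARD('d)" and \<xi>: "\<xi> \<in> M_space \<T> k" and zero: "lambda_norm \<T> \<xi> = 0"
  shows "\<xi> = (\<lambda>_ _. 0)"
proof -
  have pos: "0 < diameter F" if "F \<in> facets \<T>" for F using diameter_facet_pos d that by blast
  have nonneg: "0 \<le> diameter F * (LINT x:F|surface_measure F. (\<xi> F x)\<^sup>2)"
    if "F \<in> facets \<T>" for F
    using pos[OF that] by (intro mult_nonneg_nonneg set_integral_nonneg) auto
  have "(\<Sum>F\<in>facets \<T>. diameter F * (LINT x:F|surface_measure F. (\<xi> F x)\<^sup>2)) = 0"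
    using zero by (simp add: lambda_norm_def)
  then have "diameter F * (LINT x:F|surface_measure F. (\<xi> F x)\<^sup>2) = 0" if "F \<in> facets \<T>" for F
    using sum_nonneg_0[OF finite_facets[OF mesh],
        of "\<lambda>F. diameter F * (LINT x:F|surface_measure F. (\<xi> F x)\<^sup>2)" F] nonneg that by blast
  then have int: "(LINT x:F|surface_measure F. (\<xi> F x)\<^sup>2) = 0" if "F \<in> facets \<T>" for F
    using that pos by fastforce
  have "\<xi> F x = 0" for F x
  proof (cases "F \<in> facets \<T> \<and> x \<in> F")
    case True
    then have "continuous_on F (\<xi> F)" using \<xi> polys_continuous by (auto simp: M_space_def)
    then have "(\<xi> F x)\<^sup>2 = 0"
      using facet_integral_zero_imp_zero[of F "\<lambda>x. (\<xi> F x)\<^sup>2" x] True int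
      by (auto intro!: continuous_intros)
    then show ?thesis by simp
  next
    case False
    then show ?thesis using \<xi> polys_outside by (fastforce simp: M_space_def)
  qed
  then show ?thesis by blast
qed

end

section \<open>Schur complements\<close>

abbreviation (input) mform :: "real mat \<Rightarrow> real vec \<Rightarrow> real vec \<Rightarrow> real" where
  "mform X x y \<equiv> scalar_prod x (X *\<^sub>v y)"

lemma mform_sym:
  assumes "A \<in> carrier_mat n n" "transpose_mat A = A" "x \<in> carrier_vec n" "y \<in> carrier_vec n"
  shows "mform A x y = mform A y x"
proof -
  have "mform A x y = scalar_prod (A *\<^sub>v x) y"
    using transpose_vec_mult_scalar[OF assms(1,4,3)] assms(2) by simp
  also have "\<dots> = mform A y x"
    using assms by (intro comm_scalar_prod[of _ n]) auto
  finally show ?thesis .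
qed

lemma mform_diff_smult:
  assumes A: "A \<in> carrier_mat n n" and x: "x \<in> carrier_vec n" and y: "y \<in> carrier_vec n"
  shows "mform A (a \<cdot>\<^sub>v x - b \<cdot>\<^sub>v y) (a \<cdot>\<^sub>v x - b \<cdot>\<^sub>v y)
    = a * a * mform A x x - a * b * mform A x y - b * a * mform A y x + b * b * mform A y y"
proof -
  have c: "A *\<^sub>v x \<in> carrier_vec n" "A *\<^sub>v y \<in> carrier_vec n"
    "a \<cdot>\<^sub>v x \<in> carrier_vec n" "b \<cdot>\<^sub>v y \<in> carrier_vec n"
    using A x y by auto
  have "A *\<^sub>v (a \<cdot>\<^sub>v x - b \<cdot>\<^sub>v y) = a \<cdot>\<^sub>v (A *\<^sub>v x) - b \<cdot>\<^sub>v (A *\<^sub>v y)"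
    using A x y by (simp add: mult_minus_distrib_mat_vec[OF A c(3,4)] mult_mat_vec)
  then show ?thesis
    using x y c by (simp add: minus_scalar_prod_distrib[of _ n] scalar_prod_minus_distrib[of _ n]
        algebra_simps)
qed

lemma spd_Cauchy_Schwarz:
  assumes "spd n A" and x: "x \<in> carrier_vec n" and y: "y \<in> carrier_vec n"
  shows "(mform A x y)\<^sup>2 \<le> mform A x x * mform A y y"
proof (cases "y = 0\<^sub>v n")
  case True
  have A: "A \<in> carrier_mat n n" using assms(1) by (simp add: spd_def)
  have "A *\<^sub>v 0\<^sub>v n = 0\<^sub>v n" using A by auto
  then show ?thesis using True x by simp
next
  case False
  have A: "A \<in> carrier_mat n n" "transpose_mat A = A"
    and pos: "\<And>z. z \<in> carrier_vec n \<Longrightarrow> z \<noteq> 0\<^sub>v n \<Longrightarrow> 0 < mform A z z"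
    using assms(1) by (auto simp: spd_def)
  have nonneg: "0 \<le> mform A z z" if "z \<in> carrier_vec n" for z
    using pos[OF that] A(1) by (cases "z = 0\<^sub>v n") auto
  define a where "a = mform A y y"
  define b where "b = mform A x y"
  have a: "0 < a" unfolding a_def by (rule pos[OF y False])
  \<comment> \<open>The vector a x - b y is a times the component of x that is A-orthogonal to y;
    its nonnegative energy is a times the defect in the inequality.\<close>
  have "0 \<le> mform A (a \<cdot>\<^sub>v x - b \<cdot>\<^sub>v y) (a \<cdot>\<^sub>v x - b \<cdot>\<^sub>v y)"
    using x y by (intro nonneg) auto
  also have "\<dots> = a * (a * mform A x x - b\<^sup>2)"
    unfolding mform_diff_smult[OF A(1) x y] mform_sym[OF A y x] a_def[symmetric] b_def[symmetric]
    by (simp add: algebra_simps power2_eq_square)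
  finally have "0 \<le> a * mform A x x - b\<^sup>2" using a by (simp add: zero_le_mult_iff)
  then show ?thesis by (simp add: a_def b_def mult.commute)
qed

text \<open>Definiteness makes the kernel trivial, so the determinant is nonzero. Transposing A A' =
  1 shows that the transpose of A' is also a left inverse of A, hence equal to A'.\<close>

lemma spd_inverse:
  assumes "spd n A"
  obtains A' where "mat_inverse A = Some A'" "A' \<in> carrier_mat n n"
    "A * A' = 1\<^sub>m n" "A' * A = 1\<^sub>m n" "transpose_mat A' = A'"
proof -
  have A: "A \<in> carrier_mat n n" "transpose_mat A = A"
    and pos: "\<And>z. z \<in> carrier_vec n \<Longrightarrow> z \<noteq> 0\<^sub>v n \<Longrightarrow> 0 < mform A z z"
    using assms by (auto simp: spd_def)
  have "det A \<noteq> 0"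
  proof
    assume "det A = 0"
    then obtain v where v: "v \<in> carrier_vec n" "v \<noteq> 0\<^sub>v n" "A *\<^sub>v v = 0\<^sub>v n"
      using det_0_iff_vec_prod_zero[OF A(1)] by blast
    then show False using pos[OF v(1,2)] by simp
  qed
  then have "A \<in> Units (ring_mat TYPE(real) n ())" by (rule det_non_zero_imp_unit[OF A(1)])
  then have "mat_inverse A \<noteq> None" using mat_inverse(1)[OF A(1), of "()"] by blast
  then obtain A' where inv: "mat_inverse A = Some A'" by blast
  then have A': "A * A' = 1\<^sub>m n" "A' * A = 1\<^sub>m n" "A' \<in> carrier_mat n n"
    using mat_inverse(2)[OF A(1)] by auto
  have "transpose_mat A' * A = 1\<^sub>m n"
    using transpose_mult[OF A(1) A'(3)] A(2) A'(1) by simp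
  then have "transpose_mat A' = A'"
    using assoc_mult_mat[of "transpose_mat A'" n n A n A' n] A(1) A' by simp
  then show thesis using that inv A' by blast
qed

lemma schur_complement_symmetric:
  assumes "spd n A" and B: "B \<in> carrier_mat m n"
  shows "schur_complement A B \<in> carrier_mat m m"
    and "transpose_mat (schur_complement A B) = schur_complement A B"
proof -
  obtain A' where A': "mat_inverse A = Some A'" "A' \<in> carrier_mat n n" "transpose_mat A' = A'"
    using spd_inverse[OF assms(1)] by metis
  have BT: "transpose_mat B \<in> carrier_mat n m" using B by simp
  have BA: "B * A' \<in> carrier_mat m n" using B A'(2) by simp
  show "schur_complement A B \<in> carrier_mat m m"
    using BA BT A'(1) by (simp add: schur_complement_def)
  have "transpose_mat (B * A' * transpose_mat B) = B * (A' * transpose_mat B)"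
    using transpose_mult[OF BA BT] transpose_mult[OF B A'(2)] A'(3) by simp
  also have "\<dots> = B * A' * transpose_mat B"
    using assoc_mult_mat[OF B A'(2) BT] by simp
  finally show "transpose_mat (schur_complement A B) = schur_complement A B"
    using A'(1) by (simp add: schur_complement_def)
qed

text \<open>The vector y is A^-1 B^T x, the Riesz representative of v \<mapsto> x^T B v in the A
  inner product; x^T S x = x^T B y is then its energy.\<close>

lemma schur_complement_riesz:
  assumes "spd n A" and B: "B \<in> carrier_mat m n" and x: "x \<in> carrier_vec m"
  obtains y where "y \<in> carrier_vec n" "\<And>v. v \<in> carrier_vec n \<Longrightarrow> mform B x v = mform A y v"
    "mform (schur_complement A B) x x = mform A y y"
proof -
  have A: "A \<in> carrier_mat n n" "transpose_mat A = A" using assms(1) by (auto simp: spd_def)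
  obtain A' where A': "mat_inverse A = Some A'" "A' \<in> carrier_mat n n" "A * A' = 1\<^sub>m n"
    using spd_inverse[OF assms(1)] by metis
  have BT: "transpose_mat B \<in> carrier_mat n m" using B by simp
  define z where "z = transpose_mat B *\<^sub>v x"
  define y where "y = A' *\<^sub>v z"
  have z: "z \<in> carrier_vec n" unfolding z_def using BT x by simp
  have y: "y \<in> carrier_vec n" unfolding y_def using A'(2) z by simp
  have Ay: "A *\<^sub>v y = z"
    unfolding y_def using assoc_mult_mat_vec[OF A(1) A'(2) z, symmetric] A'(3) z by simp
  have riesz: "mform B x v = mform A y v" if v: "v \<in> carrier_vec n" for v
  proof -
    have "mform B x v = scalar_prod z v"
      unfolding z_def using transpose_vec_mult_scalar[OF B v x] by simp
    also have "\<dots> = mform A y v"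
      using transpose_vec_mult_scalar[OF A(1) v y] A(2) Ay by simp
    finally show ?thesis .
  qed
  have "schur_complement A B *\<^sub>v x = B *\<^sub>v y"
    unfolding schur_complement_def y_def z_def
    using B A' BT x assoc_mult_mat_vec[of "B * A'" m n "transpose_mat B" m x]
      assoc_mult_mat_vec[OF B A'(2), of "transpose_mat B *\<^sub>v x"] by simp
  then have "mform (schur_complement A B) x x = mform A y y" using riesz[OF y] by simp
  then show thesis using that[OF y riesz] by blast
qed

lemma spd_nonneg:
  assumes "spd n A" "x \<in> carrier_vec n"
  shows "0 \<le> mform A x x"
proof (cases "x = 0\<^sub>v n")
  case True
  then show ?thesis using assms by (auto simp: spd_def)
next
  case False
  then show ?thesis using assms by (auto simp: spd_def intro: less_imp_le)
qed

text \<open>Cauchy-Schwarz for the A inner product, applied to the Riesz representative.\<close>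

lemma schur_complement_dual_bound:
  assumes "spd n A" "B \<in> carrier_mat m n" "x \<in> carrier_vec m" "v \<in> carrier_vec n"
  shows "\<bar>mform B x v\<bar> \<le> sqrt (mform (schur_complement A B) x x) * sqrt (mform A v v)"
proof -
  obtain y where y: "y \<in> carrier_vec n" "mform B x v = mform A y v"
    "mform (schur_complement A B) x x = mform A y y"
    by (rule schur_complement_riesz[OF assms(1-3)]) (use assms(4) in blast)
  have "\<bar>mform A y v\<bar> = sqrt ((mform A y v)\<^sup>2)" by simp
  also have "\<dots> \<le> sqrt (mform A y y * mform A v v)"
    using spd_Cauchy_Schwarz[OF assms(1) y(1) assms(4)] by (rule real_sqrt_le_mono)
  finally show ?thesis using y by (simp add: real_sqrt_mult)
qed

text \<open>Test the bound with the Riesz representative itself: with s its energy norm this reads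
  s^2 \<le> \<kappa> s. The case s = 0 is separate only because s is cancelled.\<close>

lemma schur_complement_le:
  assumes "spd n A" "B \<in> carrier_mat m n" "x \<in> carrier_vec m"
    and bound: "\<And>v. v \<in> carrier_vec n \<Longrightarrow> \<bar>mform B x v\<bar> \<le> \<kappa> * sqrt (mform A v v)"
    and "0 \<le> \<kappa>"
  shows "mform (schur_complement A B) x x \<le> \<kappa>\<^sup>2"
proof -
  obtain y where y: "y \<in> carrier_vec n" "mform B x y = mform A y y"
    "mform (schur_complement A B) x x = mform A y y"
    by (rule schur_complement_riesz[OF assms(1-3)]) blast
  define s where "s = sqrt (mform A y y)"
  have s: "0 \<le> s" "mform A y y = s * s"
    using spd_nonneg[OF assms(1) y(1)] by (auto simp: s_def)
  have "mform A y y \<le> \<kappa> * s" using bound[OF y(1)] y(2) unfolding s_def by linarith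
  then have "s * s \<le> \<kappa> * s" using s(2) by simp
  then have "s \<le> \<kappa>" using s(1) \<open>0 \<le> \<kappa>\<close> by (cases "s = 0") auto
  then have "s\<^sup>2 \<le> \<kappa>\<^sup>2" using s(1) by (rule power_mono)
  then show ?thesis using y(3) s(2) by (simp add: power2_eq_square)
qed

section \<open>Block diagonal and stacked matrices\<close>

lemma diag_block_mat_two:
  assumes P: "P \<in> carrier_mat n n" and R: "R \<in> carrier_mat m m"
  shows "diag_block_mat [P, R] = four_block_mat P (0\<^sub>m n m) (0\<^sub>m m n) R"
proof -
  \<comment> \<open>The recursion of \<open>diag_block_mat\<close> ends with an empty matrix, so the
    last block comes bordered by blocks of size 0.\<close>
  have "four_block_mat R (0\<^sub>m m 0) (0\<^sub>m 0 m) (0\<^sub>m 0 0) = R" using R by auto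
  then show ?thesis using P R by (simp add: Let_def)
qed

lemma mform_diag_block_mat:
  assumes P: "P \<in> carrier_mat n n" and R: "R \<in> carrier_mat m m"
    and p: "p \<in> carrier_vec n" and r: "r \<in> carrier_vec m"
  shows "mform (diag_block_mat [P, R]) (p @\<^sub>v r) (p @\<^sub>v r) = mform P p p + mform R r r"
proof -
  have "diag_block_mat [P, R] *\<^sub>v (p @\<^sub>v r) = (P *\<^sub>v p) @\<^sub>v (R *\<^sub>v r)"
    unfolding diag_block_mat_two[OF P R] by (rule mult_mat_vec_split[OF P R p r])
  then show ?thesis
    using P R p r by (simp add: scalar_prod_append[of _ n _ m])
qed

lemma diag_block_mat_symmetric:
  assumes "P \<in> carrier_mat n n" "transpose_mat P = P" "R \<in> carrier_mat m m" "transpose_mat R = R"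
  shows "diag_block_mat [P, R] \<in> carrier_mat (n + m) (n + m)"
    and "transpose_mat (diag_block_mat [P, R]) = diag_block_mat [P, R]"
proof -
  show "diag_block_mat [P, R] \<in> carrier_mat (n + m) (n + m)"
    unfolding diag_block_mat_two[OF assms(1,3)] using assms by auto
  show "transpose_mat (diag_block_mat [P, R]) = diag_block_mat [P, R]"
    unfolding diag_block_mat_two[OF assms(1,3)]
    using assms by (simp add: transpose_four_block_mat[of _ n n _ m _ m])
qed

lemma transpose_smult_mat: "transpose_mat (a \<cdot>\<^sub>m A) = a \<cdot>\<^sub>m transpose_mat A"
  by (rule eq_matI) auto

lemma mform_smult_mat:
  assumes "A \<in> carrier_mat n n" "x \<in> carrier_vec n" "y \<in> carrier_vec n"
  shows "mform (a \<cdot>\<^sub>m A) x y = a * mform A x y"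
proof -
  have "(a \<cdot>\<^sub>m A) *\<^sub>v y = a \<cdot>\<^sub>v (A *\<^sub>v y)"
    using assms by (intro eq_vecI) (auto simp: scalar_prod_def sum_distrib_left mult.assoc)
  then show ?thesis using assms by simp
qed

text \<open>The dual norm estimates restated for the stacked matrix, with its form split into the
  pressure part and the facet part, which is how \<open>b_form\<close> presents it.\<close>

lemma schur_complement_bounds:
  fixes A B C Q M :: "real mat"
  assumes A: "spd n_u A" and B: "B \<in> carrier_mat n_p n_u" and C: "C \<in> carrier_mat n_l n_u"
    and p: "p \<in> carrier_vec n_p" and r: "r \<in> carrier_vec n_l"
    and upper: "\<And>v. v \<in> carrier_vec n_u \<Longrightarrow> \<bar>mform B p v + mform C r v\<bar> \<le> \<kappa> * sqrt (mform A v v)"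
    and \<kappa>: "0 \<le> \<kappa>"
  shows "mform (schur_complement A (B @\<^sub>r C)) (p @\<^sub>v r) (p @\<^sub>v r) \<le> \<kappa>\<^sup>2"
    and "v \<in> carrier_vec n_u \<Longrightarrow> \<bar>mform B p v + mform C r v\<bar> \<le>
      sqrt (mform (schur_complement A (B @\<^sub>r C)) (p @\<^sub>v r) (p @\<^sub>v r)) * sqrt (mform A v v)"
proof -
  have BC: "B @\<^sub>r C \<in> carrier_mat (n_p + n_l) n_u" using B C by simp
  have pr: "p @\<^sub>v r \<in> carrier_vec (n_p + n_l)" using p r by simp
  have eq: "mform (B @\<^sub>r C) (p @\<^sub>v r) v = mform B p v + mform C r v"
    if "v \<in> carrier_vec n_u" for v
    using mat_mult_append[OF B C that] B C p r that
    by (simp add: scalar_prod_append[of _ n_p _ n_l])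
  show "mform (schur_complement A (B @\<^sub>r C)) (p @\<^sub>v r) (p @\<^sub>v r) \<le> \<kappa>\<^sup>2"
    by (rule schur_complement_le[OF A BC pr _ \<kappa>]) (simp add: eq upper)
  show "v \<in> carrier_vec n_u \<Longrightarrow> \<bar>mform B p v + mform C r v\<bar> \<le>
      sqrt (mform (schur_complement A (B @\<^sub>r C)) (p @\<^sub>v r) (p @\<^sub>v r)) * sqrt (mform A v v)"
    using schur_complement_dual_bound[OF A BC pr] eq by metis
qed

section \<open>Coefficient vectors\<close>

lemma polys_0: "(\<lambda>_. 0) \<in> polys k D"
  unfolding polys_def by (auto intro!: exI[of _ "\<lambda>_. 0"])

lemma polys_add:
  assumes "f \<in> polys k D" "g \<in> polys k D"
  shows "(\<lambda>x. f x + g x) \<in> polys k D"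
proof -
  obtain c c' where
    "\<And>x. f x = (if x \<in> D then \<Sum>\<alpha> | sum \<alpha> UNIV \<le> k. c \<alpha> * (\<Prod>i\<in>UNIV. (x $ i) ^ \<alpha> i) else 0)"
    "\<And>x. g x = (if x \<in> D then \<Sum>\<alpha> | sum \<alpha> UNIV \<le> k. c' \<alpha> * (\<Prod>i\<in>UNIV. (x $ i) ^ \<alpha> i) else 0)"
    using assms unfolding polys_def by blast
  then show ?thesis
    unfolding polys_def
    by (auto intro!: exI[of _ "\<lambda>\<alpha>. c \<alpha> + c' \<alpha>"] simp: sum.distrib distrib_right)
qed

lemma polys_scale:
  assumes "f \<in> polys k D"
  shows "(\<lambda>x. a * f x) \<in> polys k D"
proof -
  obtain c where
    "\<And>x. f x = (if x \<in> D then \<Sum>\<alpha> | sum \<alpha> UNIV \<le> k. c \<alpha> * (\<Prod>i\<in>UNIV. (x $ i) ^ \<alpha> i) else 0)"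
    using assms unfolding polys_def by blast
  then show ?thesis
    unfolding polys_def
    by (auto intro!: exI[of _ "\<lambda>\<alpha>. a * c \<alpha>"] simp: sum_distrib_left mult.assoc)
qed

text \<open>Closure under f + a g in a single condition matches the induction in
  \<open>from_coeffs_mem\<close>, which adds one basis function at a time.\<close>

definition broken_subspace :: "('d, 'b::real_vector) broken set \<Rightarrow> bool" where
  "broken_subspace W \<longleftrightarrow> (\<lambda>_ _. 0) \<in> W \<and>
     (\<forall>f\<in>W. \<forall>g\<in>W. \<forall>a. (\<lambda>S x. f S x + a *\<^sub>R g S x) \<in> W)"

lemma from_coeffs_mem:
  assumes W: "broken_subspace W" and b: "is_basis n \<phi> W" and c: "c \<in> carrier_vec n"
  shows "from_coeffs \<phi> c \<in> W"
proof -
  have "(\<lambda>S x. \<Sum>i<m. (vec_index c i) *\<^sub>R \<phi> i S x) \<in> W" if "m \<le> n" for m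
    using that
  proof (induction m)
    case 0
    then show ?case using W by (simp add: broken_subspace_def)
  next
    case (Suc m)
    then have "\<phi> m \<in> W" using b by (simp add: is_basis_def)
    then show ?case using Suc W by (simp add: broken_subspace_def)
  qed
  then show ?thesis using c by (simp add: from_coeffs_def carrier_vecD)
qed

lemma from_coeffs_nonzero:
  assumes "is_basis n \<phi> W" "c \<in> carrier_vec n" "c \<noteq> 0\<^sub>v n"
  shows "from_coeffs \<phi> c \<noteq> (\<lambda>_ _. 0)"
  using assms by (auto simp: is_basis_def)

lemma broken_subspace_V: "broken_subspace (V_space \<T> k)"
  unfolding broken_subspace_def V_space_def by (auto intro!: polys_0 polys_add polys_scale)

lemma broken_subspace_M: "broken_subspace (M_space \<T> k)"
  unfolding broken_subspace_def M_space_def by (auto intro!: polys_0 polys_add polys_scale)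

text \<open>Unlike the other two spaces, this one carries the mean value constraint. Its linearity
  requires integrability of the pieces, which holds since they are continuous on compact
  cells.\<close>

lemma broken_subspace_Q:
  assumes mesh: "simplicial_mesh \<Omega> \<T>"
  shows "broken_subspace (Q_space \<T> k)"
proof -
  have si: "set_integrable lborel K f" if "K \<in> \<T>" "f \<in> polys k K" for K and f :: "real^'a \<Rightarrow> real"
    unfolding set_integrable_def
    using borel_integrable_compact[OF mesh_cell(4)[OF mesh that(1)] polys_continuous[OF that(2)]] .
  have "(\<Sum>K\<in>\<T>. LINT x:K|lborel. f K x + a * g K x) = 0"
    if f: "\<forall>K\<in>\<T>. f K \<in> polys k K" "(\<Sum>K\<in>\<T>. LINT x:K|lborel. f K x) = 0"
      and g: "\<forall>K\<in>\<T>. g K \<in> polys k K" "(\<Sum>K\<in>\<T>. LINT x:K|lborel. g K x) = 0"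
    for f g :: "('a, real) broken" and a
  proof -
    have "(LINT x:K|lborel. f K x + a * g K x) =
        (LINT x:K|lborel. f K x) + a * (LINT x:K|lborel. g K x)" if K: "K \<in> \<T>" for K
      using si[OF K, of "f K"] si[OF K, of "g K"] f(1) g(1) K by simp
    then have "(\<Sum>K\<in>\<T>. LINT x:K|lborel. f K x + a * g K x) =
        (\<Sum>K\<in>\<T>. LINT x:K|lborel. f K x) + a * (\<Sum>K\<in>\<T>. LINT x:K|lborel. g K x)"
      by (simp add: sum.distrib sum_distrib_left)
    then show ?thesis using f(2) g(2) by simp
  qed
  then show ?thesis
    unfolding broken_subspace_def Q_space_def
    by (auto intro!: polys_0 polys_add polys_scale)
qed

section \<open>Spectral bounds\<close>

text \<open>The index \<open>h\<close> ranges over a family of meshes while the constants are fixed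
  outside it, which expresses independence of the mesh. The stated bounds are for the square root of
  the quotient; the quotient itself lies between c_I^2 / c_a and c_b^2 / \<alpha>.\<close>

theorem lemma1:
  fixes \<Omega> :: "(real^'d) set"
    and \<T> :: "'i \<Rightarrow> (real^'d) set set"
    and kp :: "'i \<Rightarrow> (real^'d) set \<Rightarrow> (real^'d) set"
    and k :: nat
    and \<eta> \<alpha> c_a c_b \<beta> \<beta>_l c_i c_I \<omega>_q \<omega>_m :: real
    and n_u n_p n_l :: "'i \<Rightarrow> nat"
    and \<phi> :: "'i \<Rightarrow> nat \<Rightarrow> ('d, real^'d) broken"
    and \<psi> \<zeta> :: "'i \<Rightarrow> nat \<Rightarrow> ('d, real) broken"
    and A B C Q M \<B> \<S> \<M> :: "'i \<Rightarrow> real mat"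
  assumes dim: "CARD('d) = 2 \<or> CARD('d) = 3"
    and k: "1 \<le> k"
    and mesh: "\<And>h. simplicial_mesh \<Omega> (\<T> h)"
    and labelling: "\<And>h. facet_labelling (\<T> h) (kp h)"
    and penalty: "0 < \<eta>"
    and basis_V: "\<And>h. is_basis (n_u h) (\<phi> h) (V_space (\<T> h) k)"
    and basis_Q: "\<And>h. is_basis (n_p h) (\<psi> h) (Q_space (\<T> h) (k - 1))"
    and basis_M: "\<And>h. is_basis (n_l h) (\<zeta> h) (M_space (\<T> h) k)"
    and A: "\<And>h. quadratic_form_matrix (n_u h) (\<phi> h) (\<lambda>v. a_form (\<T> h) (kp h) \<eta> v v) (A h)"
    and B: "\<And>h. bilinear_form_matrix (n_p h) (\<psi> h) (n_u h) (\<phi> h)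
              (\<lambda>q v. b_form (\<T> h) (kp h) (q, \<lambda>_ _. 0) v) (B h)"
    and C: "\<And>h. bilinear_form_matrix (n_l h) (\<zeta> h) (n_u h) (\<phi> h)
              (\<lambda>\<xi> v. b_form (\<T> h) (kp h) (\<lambda>_ _. 0, \<xi>) v) (C h)"
    and Q: "\<And>h. quadratic_form_matrix (n_p h) (\<psi> h) (\<lambda>q. (l2_norm (\<T> h) q)\<^sup>2) (Q h)"
    and M: "\<And>h. quadratic_form_matrix (n_l h) (\<zeta> h) (\<lambda>\<xi>. (lambda_norm (\<T> h) \<xi>)\<^sup>2) (M h)"
    and \<B>: "\<And>h. \<B> h = B h @\<^sub>r C h"
    and \<S>: "\<And>h. \<S> h = schur_complement (A h) (\<B> h)"
    and constants: "0 < \<alpha>" "0 < c_a" "0 < c_b" "0 < \<beta>" "0 < \<beta>_l" "0 < c_i"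
    and coercive: "\<And>h v. v \<in> V_space (\<T> h) k \<Longrightarrow>
          a_form (\<T> h) (kp h) \<eta> v v \<ge> \<alpha> * (dg_norm (\<T> h) (kp h) v)\<^sup>2"
    and a_bounded: "\<And>h u v. u \<in> V_space (\<T> h) k \<Longrightarrow> v \<in> V_space (\<T> h) k \<Longrightarrow>
          \<bar>a_form (\<T> h) (kp h) \<eta> u v\<bar> \<le> c_a * dg_norm (\<T> h) (kp h) u * dg_norm (\<T> h) (kp h) v"
    and b_bounded: "\<And>h v q \<xi>. v \<in> V_space (\<T> h) k \<Longrightarrow>
          q \<in> Q_space (\<T> h) (k - 1) \<Longrightarrow> \<xi> \<in> M_space (\<T> h) k \<Longrightarrow>
          \<bar>b_form (\<T> h) (kp h) (q, \<xi>) v\<bar>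
            \<le> c_b * dg_norm (\<T> h) (kp h) v * sqrt ((l2_norm (\<T> h) q)\<^sup>2 + (lambda_norm (\<T> h) \<xi>)\<^sup>2)"
    and infsup_q: "\<And>h q. q \<in> Q_space (\<T> h) (k - 1) \<Longrightarrow>
          ereal (\<beta> * l2_norm (\<T> h) q)
            \<le> sup_quotient (\<T> h) (kp h) (BDM_space (\<T> h) (kp h) k) (b_tilde (\<T> h) q)"
    and infsup_l: "\<And>h \<xi>. \<xi> \<in> M_space (\<T> h) k \<Longrightarrow>
          ereal (\<beta>_l * lambda_norm (\<T> h) \<xi>)
            \<le> sup_quotient (\<T> h) (kp h) (V_space (\<T> h) k) (b_facet (\<T> h) (kp h) \<xi>)"
    and infsup: "\<And>h q \<xi>. q \<in> Q_space (\<T> h) (k - 1) \<Longrightarrow> \<xi> \<in> M_space (\<T> h) k \<Longrightarrow>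
          ereal (c_i * sqrt (\<beta>\<^sup>2 * (l2_norm (\<T> h) q)\<^sup>2 + \<beta>_l\<^sup>2 * (lambda_norm (\<T> h) \<xi>)\<^sup>2))
            \<le> sup_quotient (\<T> h) (kp h) (V_space (\<T> h) k) (b_form (\<T> h) (kp h) (q, \<xi>))"
    and c_I: "c_I = c_i * min \<beta> \<beta>_l"
    and \<omega>_q: "\<omega>_q = \<beta>\<^sup>2 / min (\<beta>\<^sup>2) (\<beta>_l\<^sup>2)"
    and \<omega>_m: "\<omega>_m = \<beta>_l\<^sup>2 / min (\<beta>\<^sup>2) (\<beta>_l\<^sup>2)"
    and \<M>: "\<And>h. \<M> h = diag_block_mat [\<omega>_q \<cdot>\<^sub>m Q h, \<omega>_m \<cdot>\<^sub>m M h]"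
  shows "spectrally_equivalent (\<lambda>h. n_p h + n_l h) \<M> \<S> \<and>
    (\<forall>h. \<forall>x\<in>carrier_vec (n_p h + n_l h). x \<noteq> 0\<^sub>v (n_p h + n_l h) \<longrightarrow>
       c_I / sqrt c_a \<le> sqrt (scalar_prod x (\<S> h *\<^sub>v x) / scalar_prod x (\<M> h *\<^sub>v x)) \<and>
       sqrt (scalar_prod x (\<S> h *\<^sub>v x) / scalar_prod x (\<M> h *\<^sub>v x)) \<le> c_b / sqrt \<alpha>)"
proof -
  \<comment> \<open>Dividing by \<mu> makes the smaller of the two weights 1, so both are at least
    1.\<close>
  define \<mu> where "\<mu> = min (\<beta>\<^sup>2) (\<beta>_l\<^sup>2)"
  have \<mu>: "0 < \<mu>" "\<mu> \<le> \<beta>\<^sup>2" "\<mu> \<le> \<beta>_l\<^sup>2" using constants by (auto simp: \<mu>_def)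
  have cI: "0 < c_I" using constants by (simp add: c_I)
  have "(min \<beta> \<beta>_l)\<^sup>2 = \<mu>"
    using constants by (auto simp: \<mu>_def min_def power_mono dest: power2_le_imp_le)
  then have cI2: "c_I\<^sup>2 = c_i\<^sup>2 * \<mu>" by (simp add: c_I power_mult_distrib)
  have \<omega>: "1 \<le> \<omega>_q" "1 \<le> \<omega>_m" "\<omega>_q * \<mu> = \<beta>\<^sup>2" "\<omega>_m * \<mu> = \<beta>_l\<^sup>2"
    using \<mu> by (auto simp: \<omega>_q \<omega>_m \<mu>_def[symmetric] le_divide_eq)
  have d: "2 \<le> CARD('d)" using dim by auto
  \<comment> \<open>The bounds are first stated without division, so that x = 0 needs no exception
    and definiteness of \<open>\<S> h\<close> can be deduced from them.\<close>
  have main: "spd (n_p h + n_l h) (\<M> h) \<and> \<S> h \<in> carrier_mat (n_p h + n_l h) (n_p h + n_l h) \<and>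
      transpose_mat (\<S> h) = \<S> h \<and>
      (\<forall>x\<in>carrier_vec (n_p h + n_l h).
        c_I\<^sup>2 / c_a * mform (\<M> h) x x \<le> mform (\<S> h) x x \<and>
        mform (\<S> h) x x \<le> c_b\<^sup>2 / \<alpha> * mform (\<M> h) x x)" for h
  proof -
    note mesh_h = mesh[of h] and lab_h = labelling[of h]
    let ?dg = "dg_norm (\<T> h) (kp h)"
    have V: "from_coeffs (\<phi> h) v \<in> V_space (\<T> h) k" if "v \<in> carrier_vec (n_u h)" for v
      using from_coeffs_mem[OF broken_subspace_V basis_V that] .
    have Qs: "from_coeffs (\<psi> h) q \<in> Q_space (\<T> h) (k - 1)" if "q \<in> carrier_vec (n_p h)" for q
      using from_coeffs_mem[OF broken_subspace_Q[OF mesh_h] basis_Q that] .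
    have Ms: "from_coeffs (\<zeta> h) \<xi> \<in> M_space (\<T> h) k" if "\<xi> \<in> carrier_vec (n_l h)" for \<xi>
      using from_coeffs_mem[OF broken_subspace_M basis_M that] .
    have A_h: "A h \<in> carrier_mat (n_u h) (n_u h)" "transpose_mat (A h) = A h"
      "\<And>v. v \<in> carrier_vec (n_u h) \<Longrightarrow>
        a_form (\<T> h) (kp h) \<eta> (from_coeffs (\<phi> h) v) (from_coeffs (\<phi> h) v) = mform (A h) v v"
      using A[of h] by (auto simp: quadratic_form_matrix_def)
    have Q_h: "Q h \<in> carrier_mat (n_p h) (n_p h)" "transpose_mat (Q h) = Q h"
      "\<And>q. q \<in> carrier_vec (n_p h) \<Longrightarrow> (l2_norm (\<T> h) (from_coeffs (\<psi> h) q))\<^sup>2 = mform (Q h) q q"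
      using Q[of h] by (auto simp: quadratic_form_matrix_def)
    have M_h: "M h \<in> carrier_mat (n_l h) (n_l h)" "transpose_mat (M h) = M h"
      "\<And>\<xi>. \<xi> \<in> carrier_vec (n_l h) \<Longrightarrow>
        (lambda_norm (\<T> h) (from_coeffs (\<zeta> h) \<xi>))\<^sup>2 = mform (M h) \<xi> \<xi>"
      using M[of h] by (auto simp: quadratic_form_matrix_def)
    have B_h: "B h \<in> carrier_mat (n_p h) (n_u h)"
      "\<And>q v. q \<in> carrier_vec (n_p h) \<Longrightarrow> v \<in> carrier_vec (n_u h) \<Longrightarrow>
        b_form (\<T> h) (kp h) (from_coeffs (\<psi> h) q, \<lambda>_ _. 0) (from_coeffs (\<phi> h) v) = mform (B h) q v"
      using B[of h] by (auto simp: bilinear_form_matrix_def)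
    have C_h: "C h \<in> carrier_mat (n_l h) (n_u h)"
      "\<And>\<xi> v. \<xi> \<in> carrier_vec (n_l h) \<Longrightarrow> v \<in> carrier_vec (n_u h) \<Longrightarrow>
        b_form (\<T> h) (kp h) (\<lambda>_ _. 0, from_coeffs (\<zeta> h) \<xi>) (from_coeffs (\<phi> h) v) = mform (C h) \<xi> v"
      using C[of h] by (auto simp: bilinear_form_matrix_def)
    \<comment> \<open>The matrices B and C see one argument of the form at a time; with the other
      set to 0 its integrals vanish, and the two values add up.\<close>
    have b_mform: "b_form (\<T> h) (kp h) (from_coeffs (\<psi> h) q, from_coeffs (\<zeta> h) \<xi>) (from_coeffs (\<phi> h) v)
        = mform (B h) q v + mform (C h) \<xi> v"
      if "q \<in> carrier_vec (n_p h)" "\<xi> \<in> carrier_vec (n_l h)" "v \<in> carrier_vec (n_u h)" for q \<xi> v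
      unfolding B_h(2)[OF that(1,3), symmetric] C_h(2)[OF that(2,3), symmetric]
      by (simp add: b_form_def b_tilde_def b_facet_def set_lebesgue_integral_def)
    have spd_A: "spd (n_u h) (A h)"
      unfolding spd_def
    proof (intro conjI ballI impI A_h(1,2))
      fix v :: "real vec" assume v: "v \<in> carrier_vec (n_u h)" "v \<noteq> 0\<^sub>v (n_u h)"
      let ?v = "from_coeffs (\<phi> h) v"
      \<comment> \<open>Coercivity alone gives only semidefiniteness; definiteness of the discrete
        norm makes the bound strict.\<close>
      have "?dg ?v \<noteq> 0"
        using dg_norm_eq_0[OF mesh_h lab_h d V[OF v(1)]] from_coeffs_nonzero[OF basis_V v] by blast
      then have "0 < \<alpha> * (?dg ?v)\<^sup>2" using constants(1) by simp
      then show "0 < mform (A h) v v"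
        using coercive[OF V[OF v(1)]] A_h(3)[OF v(1)] by linarith
    qed
    have M_form: "mform (\<M> h) (q @\<^sub>v \<xi>) (q @\<^sub>v \<xi>) = \<omega>_q * (l2_norm (\<T> h) (from_coeffs (\<psi> h) q))\<^sup>2
        + \<omega>_m * (lambda_norm (\<T> h) (from_coeffs (\<zeta> h) \<xi>))\<^sup>2"
      if "q \<in> carrier_vec (n_p h)" "\<xi> \<in> carrier_vec (n_l h)" for q \<xi> :: "real vec"
    proof -
      have "mform (\<M> h) (q @\<^sub>v \<xi>) (q @\<^sub>v \<xi>) =
          mform (\<omega>_q \<cdot>\<^sub>m Q h) q q + mform (\<omega>_m \<cdot>\<^sub>m M h) \<xi> \<xi>"
        unfolding \<M> using Q_h(1) M_h(1) that by (intro mform_diag_block_mat) auto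
      also have "\<dots> = \<omega>_q * mform (Q h) q q + \<omega>_m * mform (M h) \<xi> \<xi>"
        using Q_h(1) M_h(1) that by (simp add: mform_smult_mat)
      finally show ?thesis using Q_h(3)[OF that(1)] M_h(3)[OF that(2)] by simp
    qed
    have spd_M: "spd (n_p h + n_l h) (\<M> h)"
      unfolding spd_def
    proof (intro conjI ballI impI)
      show "\<M> h \<in> carrier_mat (n_p h + n_l h) (n_p h + n_l h)" "transpose_mat (\<M> h) = \<M> h"
        unfolding \<M> using Q_h(1,2) M_h(1,2)
        by (auto intro!: diag_block_mat_symmetric simp: transpose_smult_mat simp del: diag_block_mat.simps)
      fix x :: "real vec" assume x: "x \<in> carrier_vec (n_p h + n_l h)" "x \<noteq> 0\<^sub>v (n_p h + n_l h)"
      obtain q \<xi> :: "real vec" where qx: "x = q @\<^sub>v \<xi>" "q \<in> carrier_vec (n_p h)" "\<xi> \<in> carrier_vec (n_l h)"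
        using x(1) vec_first_last_append vec_first_carrier vec_last_carrier by metis
      have "q \<noteq> 0\<^sub>v (n_p h) \<or> \<xi> \<noteq> 0\<^sub>v (n_l h)" using x(2) qx by auto
      then have "l2_norm (\<T> h) (from_coeffs (\<psi> h) q) \<noteq> 0 \<or> lambda_norm (\<T> h) (from_coeffs (\<zeta> h) \<xi>) \<noteq> 0"
        using l2_norm_eq_0[OF mesh_h Qs[OF qx(2)]] lambda_norm_eq_0[OF mesh_h lab_h d Ms[OF qx(3)]]
          from_coeffs_nonzero[OF basis_Q qx(2)] from_coeffs_nonzero[OF basis_M qx(3)] by blast
      then show "0 < mform (\<M> h) x x"
        unfolding qx(1) M_form[OF qx(2,3)] using \<omega>(1,2)
        by (auto intro: add_pos_nonneg add_nonneg_pos)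
    qed
    have BC: "\<B> h \<in> carrier_mat (n_p h + n_l h) (n_u h)" unfolding \<B> using B_h(1) C_h(1) by simp
    have bounds: "c_I\<^sup>2 / c_a * mform (\<M> h) x x \<le> mform (\<S> h) x x \<and>
        mform (\<S> h) x x \<le> c_b\<^sup>2 / \<alpha> * mform (\<M> h) x x"
      if x: "x \<in> carrier_vec (n_p h + n_l h)" for x :: "real vec"
    proof -
      obtain q \<xi> :: "real vec" where qx: "x = q @\<^sub>v \<xi>" "q \<in> carrier_vec (n_p h)" "\<xi> \<in> carrier_vec (n_l h)"
        using x vec_first_last_append vec_first_carrier vec_last_carrier by metis
      let ?q = "from_coeffs (\<psi> h) q" and ?\<xi> = "from_coeffs (\<zeta> h) \<xi>"
      let ?b = "b_form (\<T> h) (kp h) (?q, ?\<xi>)"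
      define l where "l = l2_norm (\<T> h) ?q"
      define r where "r = lambda_norm (\<T> h) ?\<xi>"
      define m where "m = mform (\<M> h) x x"
      define s where "s = mform (\<S> h) x x"
      have m: "m = \<omega>_q * l\<^sup>2 + \<omega>_m * r\<^sup>2"
        unfolding m_def qx(1) M_form[OF qx(2,3)] l_def r_def ..
      \<comment> \<open>The boundedness of b uses the unweighted norm; weights of at least 1 let the
        preconditioner dominate it.\<close>
      have lr: "l\<^sup>2 + r\<^sup>2 \<le> m"
        unfolding m using \<omega>(1,2) by (intro add_mono) (simp_all add: mult_le_cancel_right1)
      then have m0: "0 \<le> m" by (meson order_trans sum_power2_ge_zero)
      \<comment> \<open>The factor c_b comes from boundedness of b, 1 / sqrt \<alpha> from replacing
        the discrete norm by the energy norm, and sqrt m from \<open>lr\<close>.\<close>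
      define \<kappa> where "\<kappa> = c_b * sqrt m / sqrt \<alpha>"
      have \<kappa>: "0 \<le> \<kappa>" using constants m0 by (simp add: \<kappa>_def)
      have upper: "\<bar>mform (B h) q v + mform (C h) \<xi> v\<bar> \<le> \<kappa> * sqrt (mform (A h) v v)"
        if v: "v \<in> carrier_vec (n_u h)" for v :: "real vec"
      proof -
        let ?v = "from_coeffs (\<phi> h) v"
        have dg0: "0 \<le> ?dg ?v" by (rule dg_norm_nonneg[OF mesh_h lab_h])
        have "\<alpha> * (?dg ?v)\<^sup>2 \<le> mform (A h) v v"
          using coercive[OF V[OF v]] A_h(3)[OF v] by simp
        then have "(?dg ?v)\<^sup>2 \<le> mform (A h) v v / \<alpha>"
          using constants(1) by (simp add: field_simps)
        then have "?dg ?v \<le> sqrt (mform (A h) v v / \<alpha>)" by (rule real_le_rsqrt)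
        then have dg: "?dg ?v \<le> sqrt (mform (A h) v v) / sqrt \<alpha>" by (simp add: real_sqrt_divide)
        have "\<bar>?b ?v\<bar> \<le> c_b * ?dg ?v * sqrt (l\<^sup>2 + r\<^sup>2)"
          unfolding l_def r_def using b_bounded[OF V[OF v] Qs[OF qx(2)] Ms[OF qx(3)]] .
        also have "\<dots> \<le> c_b * (sqrt (mform (A h) v v) / sqrt \<alpha>) * sqrt m"
          using constants(3) dg0 dg lr order_trans[OF dg0 dg]
          by (intro mult_mono mult_left_mono real_sqrt_le_mono mult_nonneg_nonneg) auto
        finally show ?thesis
          unfolding b_mform[OF qx(2,3) v] \<kappa>_def by (simp add: mult_ac)
      qed
      obtain y where "y \<in> carrier_vec (n_u h)" "s = mform (A h) y y"
        unfolding s_def \<S> by (rule schur_complement_riesz[OF spd_A BC x]) blast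
      then have s0: "0 \<le> s" using spd_nonneg[OF spd_A] by simp
      have S: "\<S> h = schur_complement (A h) (B h @\<^sub>r C h)" unfolding \<S> \<B> ..
      have "s \<le> \<kappa>\<^sup>2"
        unfolding s_def S qx(1)
        by (rule schur_complement_bounds(1)[OF spd_A B_h(1) C_h(1) qx(2,3) upper \<kappa>])
      also have "\<kappa>\<^sup>2 = c_b\<^sup>2 / \<alpha> * m"
        using m0 constants(1) by (simp add: \<kappa>_def power_mult_distrib power_divide)
      finally have le: "s \<le> c_b\<^sup>2 / \<alpha> * m" .
      \<comment> \<open>The dual bound estimates b by sqrt s times the energy norm, and boundedness
        of a turns the latter into sqrt c_a times the discrete norm.\<close>
      have "sup_quotient (\<T> h) (kp h) (V_space (\<T> h) k) ?b \<le> ereal (sqrt s * sqrt c_a)"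
        unfolding sup_quotient_def
      proof (rule SUP_least)
        fix w assume w: "w \<in> V_space (\<T> h) k - {\<lambda>_ _. 0}"
        then obtain v where v: "v \<in> carrier_vec (n_u h)" "w = from_coeffs (\<phi> h) v"
          using basis_V[of h] unfolding is_basis_def by blast
        \<comment> \<open>The quotient has a genuine denominator: a nonzero w has positive norm, so
          division by 0 does not occur.\<close>
        have "?dg w \<noteq> 0" using dg_norm_eq_0[OF mesh_h lab_h d] w by blast
        then have dg: "0 < ?dg w" using dg_norm_nonneg[OF mesh_h lab_h] by (metis less_eq_real_def)
        have "mform (A h) v v \<le> c_a * (?dg w)\<^sup>2"
          using a_bounded[of w h w] w A_h(3)[OF v(1)] v(2) by (simp add: power2_eq_square mult.assoc)
        then have "sqrt (mform (A h) v v) \<le> sqrt (c_a * (?dg w)\<^sup>2)" by (rule real_sqrt_le_mono)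
        also have "\<dots> = sqrt c_a * ?dg w" using dg by (simp add: real_sqrt_mult)
        finally have a: "sqrt (mform (A h) v v) \<le> sqrt c_a * ?dg w" .
        have "?b w \<le> sqrt s * sqrt (mform (A h) v v)"
          using schur_complement_bounds(2)[OF spd_A B_h(1) C_h(1) qx(2,3) upper \<kappa> v(1)]
          unfolding s_def S qx(1) v(2) b_mform[OF qx(2,3) v(1)] by linarith
        also have "\<dots> \<le> sqrt s * (sqrt c_a * ?dg w)"
          using a s0 by (intro mult_left_mono) auto
        finally show "ereal (?b w / ?dg w) \<le> ereal (sqrt s * sqrt c_a)"
          using dg by (simp add: pos_divide_le_eq mult.assoc)
      qed
      then have "ereal (c_i * sqrt (\<beta>\<^sup>2 * l\<^sup>2 + \<beta>_l\<^sup>2 * r\<^sup>2)) \<le> ereal (sqrt s * sqrt c_a)"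
        unfolding l_def r_def using infsup[OF Qs[OF qx(2)] Ms[OF qx(3)]] order_trans by blast
      \<comment> \<open>The weights are matched to the inf-sup norm, so no loss occurs here: its
        left side is exactly c_i sqrt (\<mu> m), that is, c_I sqrt m.\<close>
      moreover have "\<beta>\<^sup>2 * l\<^sup>2 + \<beta>_l\<^sup>2 * r\<^sup>2 = \<mu> * m"
        unfolding m \<omega>(3,4)[symmetric] by (simp add: algebra_simps)
      ultimately have "c_i * sqrt (\<mu> * m) \<le> sqrt s * sqrt c_a" by simp
      then have "(c_i * sqrt (\<mu> * m))\<^sup>2 \<le> (sqrt s * sqrt c_a)\<^sup>2"
        using constants \<mu>(1) m0 by (intro power_mono) auto
      then have "c_I\<^sup>2 * m \<le> s * c_a"
        using constants \<mu>(1) m0 s0 by (simp add: power_mult_distrib cI2 mult.assoc)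
      then have "c_I\<^sup>2 / c_a * m \<le> s" using constants(2) by (simp add: field_simps)
      then show ?thesis using le unfolding m_def s_def by blast
    qed
    show ?thesis
      using spd_M bounds schur_complement_symmetric[OF spd_A BC] unfolding \<S>[symmetric] by blast
  qed
  have M_pos: "0 < mform (\<M> h) x x"
    if "x \<in> carrier_vec (n_p h + n_l h)" "x \<noteq> 0\<^sub>v (n_p h + n_l h)" for h x
    using main[of h] that by (auto simp: spd_def)
  have lower: "c_I\<^sup>2 / c_a * mform (\<M> h) x x \<le> mform (\<S> h) x x"
    and upper: "mform (\<S> h) x x \<le> c_b\<^sup>2 / \<alpha> * mform (\<M> h) x x"
    if "x \<in> carrier_vec (n_p h + n_l h)" for h x
    using main[of h] that by auto
  have S_pos: "0 < mform (\<S> h) x x"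
    if x: "x \<in> carrier_vec (n_p h + n_l h)" "x \<noteq> 0\<^sub>v (n_p h + n_l h)" for h x
  proof -
    have "0 < c_I\<^sup>2 / c_a * mform (\<M> h) x x" using M_pos[OF x] cI constants(2) by simp
    then show ?thesis using lower[OF x(1)] by linarith
  qed
  \<comment> \<open>Spectral equivalence is stated for the quotient with \<open>\<S>\<close> in the
    denominator, so the two constants are inverted and exchanged.\<close>
  have "\<alpha> / c_b\<^sup>2 \<le> mform (\<M> h) x x / mform (\<S> h) x x \<and>
      mform (\<M> h) x x / mform (\<S> h) x x \<le> c_a / c_I\<^sup>2"
    if x: "x \<in> carrier_vec (n_p h + n_l h)" "x \<noteq> 0\<^sub>v (n_p h + n_l h)" for h and x :: "real vec"
    using lower[OF x(1)] upper[OF x(1)] S_pos[OF x] constants cI by (simp add: field_simps)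
  moreover have "0 < \<alpha> / c_b\<^sup>2" "0 < c_a / c_I\<^sup>2" using constants cI by auto
  moreover have "spd (n_p h + n_l h) (\<M> h)" "spd (n_p h + n_l h) (\<S> h)" for h
    using main[of h] S_pos[of _ h] unfolding spd_def by blast+
  ultimately have "spectrally_equivalent (\<lambda>h. n_p h + n_l h) \<M> \<S>"
    unfolding spectrally_equivalent_def by blast
  moreover have "c_I / sqrt c_a \<le> sqrt (mform (\<S> h) x x / mform (\<M> h) x x) \<and>
       sqrt (mform (\<S> h) x x / mform (\<M> h) x x) \<le> c_b / sqrt \<alpha>"
    if x: "x \<in> carrier_vec (n_p h + n_l h)" "x \<noteq> 0\<^sub>v (n_p h + n_l h)" for h x
  proof
    have "c_I\<^sup>2 / c_a \<le> mform (\<S> h) x x / mform (\<M> h) x x"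
      using lower[OF x(1)] M_pos[OF x] by (simp add: pos_le_divide_eq)
    then have "sqrt (c_I\<^sup>2 / c_a) \<le> sqrt (mform (\<S> h) x x / mform (\<M> h) x x)"
      by (rule real_sqrt_le_mono)
    then show "c_I / sqrt c_a \<le> sqrt (mform (\<S> h) x x / mform (\<M> h) x x)"
      using cI by (simp add: real_sqrt_divide)
    have "mform (\<S> h) x x / mform (\<M> h) x x \<le> c_b\<^sup>2 / \<alpha>"
      using upper[OF x(1)] M_pos[OF x] by (simp add: pos_divide_le_eq)
    then have "sqrt (mform (\<S> h) x x / mform (\<M> h) x x) \<le> sqrt (c_b\<^sup>2 / \<alpha>)"
      by (rule real_sqrt_le_mono)
    then show "sqrt (mform (\<S> h) x x / mform (\<M> h) x x) \<le> c_b / sqrt \<alpha>"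
      using constants(3) by (simp add: real_sqrt_divide)
  qed
  ultimately show ?thesis by blast
qed

end
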